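(* Let $X,Y$ be sets and $R\subseteq X\times Y$ a relation. Then there is a weak equivalence of filtrations indexed by $]0,\infty[^{op}$ $$|\mathcal D(X,Y,R)_\bullet|\;\simeq\;|\mathcal S(\mathcal D(Y,X,R^\top))_\bullet| .$$ Moreover, the weak equivalence is natural in the following sense: if $T$ is a poset, $X,Y$ are fixed sets, and $(R_t)_{t\in T}$ is a filtration of relations $R_t\subseteq X\times Y$ (i.e. $R_s\subseteq R_t$ whenever $s\le t$), then the two filtrations $]0,\infty[^{op}\times T\to\mathbf{Top}$ given by $$(m,t)\mapsto |\mathcal D(X,Y,R_t)_m|,\qquad (m,t)\mapsto |\mathcal S(\mathcal D(Y,X,R_t^\top))_m|$$ are weakly equivalent.
   Context: An abstract simplicial complex is a set of finite non-empty sets closed under passing to non-empty subsets; $|K|$ denotes the geometric realization of $K$. For a relation $R\subseteq X\times Y$, the Dowker complex $\mathcal D(X,Y,R)$ is the abstract simplicial complex of all non-empty finite $\sigma\subseteq X$ for which there is $y\in Y$ with $\sigma\times\{y\}\subseteq R$ (such a $y$ is a witness of $\sigma$). The transpose is $R^\top=\{(y,x):(x,y)\in R\}\subseteq Y\times X$. Total weight: $t(\sigma)=|\{y\in Y:\sigma\times\{y\}\subseteq R\}|\in\mathbb N\cup\{\infty\}$. For $m\in\,]0,\infty[$, $\mathcal D(X,Y,R)_m=\{\sigma\in\mathcal D(X,Y,R): t(\sigma)\ge m\}$. Subdivision filtration: for a simplicial complex $K$ with barycentric subdivision $\mathrm{Sd}(K)$ (whose $k$-simplices are flags $\sigma_0\subsetneq\dots\subsetneq\sigma_k$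 of simplices of $K$), $\mathcal S(K)_m$ is the subcomplex of $\mathrm{Sd}(K)$ of all flags with $\dim\sigma_0\ge m-1$, for $m\in\,]0,\infty[$. $]0,\infty[^{op}$ is the set of positive reals with reversed order. $\mathbf{Top}$ is the category of compactly generated weakly Hausdorff spaces. For a poset $P$ (viewed as a thin category), a $P$-indexed filtration is a functor $F:P\to\mathbf{Top}$ sending all morphisms to inclusions. Two filtrations are objectwise equivalent if there is a natural transformation between them all of whose components are homotopy equivalences; they are weakly equivalent ($\simeq$) if they are connected by a finite zig-zag of objectwise equivalences through filtrations. *)

theory Defs
  imports "HOL-Analysis.Analysis"
begin

section \<open>Abstract simplicial complexes and their geometric realization\<close>

definition abstract_complex :: "'v set set \<Rightarrow> bool" where
  "abstract_complex K \<longleftrightarrow>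
     (\<forall>\<sigma>\<in>K. finite \<sigma> \<and> \<sigma> \<noteq> {} \<and> (\<forall>\<tau>. \<tau> \<subseteq> \<sigma> \<and> \<tau> \<noteq> {} \<longrightarrow> \<tau> \<in> K))"

definition simplex_dim :: "'v set \<Rightarrow> int" where
  "simplex_dim \<sigma> = int (card \<sigma>) - 1"

text \<open>Points are given by their barycentric coordinates; the closed cell of \<open>\<sigma>\<close> carries the
  topology of pointwise convergence, which is the Euclidean one since \<open>\<sigma>\<close> is finite.\<close>

definition closed_cell :: "'v set \<Rightarrow> ('v \<Rightarrow> real) set" where
  "closed_cell \<sigma> = {f. (\<forall>v. 0 \<le> f v) \<and> (\<forall>v. v \<notin> \<sigma> \<longrightarrow> f v = 0) \<and> sum f \<sigma> = 1}"

text \<open>The realization carries the weak (coherent) topology, which for infinite complexes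
  is in general strictly finer than the topology of pointwise convergence.\<close>

definition realization :: "'v set set \<Rightarrow> ('v \<Rightarrow> real) topology" where
  "realization K = topology (\<lambda>U. U \<subseteq> (\<Union>\<sigma>\<in>K. closed_cell \<sigma>) \<and>
     (\<forall>\<sigma>\<in>K. openin (top_of_set (closed_cell \<sigma>)) (U \<inter> closed_cell \<sigma>)))"

lemma openin_realization:
  "openin (realization K) U \<longleftrightarrow> U \<subseteq> (\<Union>\<sigma>\<in>K. closed_cell \<sigma>) \<and>
     (\<forall>\<sigma>\<in>K. openin (top_of_set (closed_cell \<sigma>)) (U \<inter> closed_cell \<sigma>))"
proof -
  have "istopology (\<lambda>U. U \<subseteq> (\<Union>\<sigma>\<in>K. closed_cell \<sigma>) \<and>
     (\<forall>\<sigma>\<in>K. openin (top_of_set (closed_cell \<sigma>)) (U \<inter> closed_cell \<sigma>)))"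
    (is "istopology ?L")
    unfolding istopology_def
  proof (intro conjI allI impI)
    fix S T assume "?L S" "?L T"
    moreover have "S \<inter> T \<inter> C = (S \<inter> C) \<inter> (T \<inter> C)" for C by blast
    ultimately show "S \<inter> T \<subseteq> (\<Union>\<sigma>\<in>K. closed_cell \<sigma>)"
      and "\<forall>\<sigma>\<in>K. openin (top_of_set (closed_cell \<sigma>)) (S \<inter> T \<inter> closed_cell \<sigma>)"
      by (auto simp: openin_Int)
  next
    fix \<U> assume \<U>: "\<forall>U\<in>\<U>. ?L U"
    then show "\<Union>\<U> \<subseteq> (\<Union>\<sigma>\<in>K. closed_cell \<sigma>)" by blast
    show "\<forall>\<sigma>\<in>K. openin (top_of_set (closed_cell \<sigma>)) (\<Union>\<U> \<inter> closed_cell \<sigma>)"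
    proof
      fix \<sigma> assume "\<sigma> \<in> K"
      with \<U> have "openin (top_of_set (closed_cell \<sigma>)) (\<Union>U\<in>\<U>. U \<inter> closed_cell \<sigma>)"
        by (intro openin_Union) blast
      then show "openin (top_of_set (closed_cell \<sigma>)) (\<Union>\<U> \<inter> closed_cell \<sigma>)"
        by (simp only: Int_Union2)
    qed
  qed
  then show ?thesis
    by (simp add: realization_def topology_inverse')
qed


section \<open>Dowker complexes, total weight and the subdivision filtration\<close>

definition dowker :: "'x set \<Rightarrow> 'y set \<Rightarrow> ('x \<times> 'y) set \<Rightarrow> 'x set set" where
  "dowker X Y R = {\<sigma>. \<sigma> \<subseteq> X \<and> finite \<sigma> \<and> \<sigma> \<noteq> {} \<and> (\<exists>y\<in>Y. \<sigma> \<times> {y} \<subseteq> R)}"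

definition total_weight :: "'y set \<Rightarrow> ('x \<times> 'y) set \<Rightarrow> 'x set \<Rightarrow> enat" where
  "total_weight Y R \<sigma> =
     (let W = {y\<in>Y. \<sigma> \<times> {y} \<subseteq> R} in if finite W then enat (card W) else \<infinity>)"

definition dowker_weight :: "'x set \<Rightarrow> 'y set \<Rightarrow> ('x \<times> 'y) set \<Rightarrow> real \<Rightarrow> 'x set set" where
  "dowker_weight X Y R m =
     {\<sigma> \<in> dowker X Y R. ereal m \<le> ereal_of_enat (total_weight Y R \<sigma>)}"

text \<open>A flag \<open>\<sigma>\<^sub>0 \<subset> \<dots> \<subset> \<sigma>\<^sub>k\<close> is encoded as the set of its members, so that the
  vertices of the subdivision are the simplices of \<open>K\<close>.\<close>

definition Sd :: "'v set set \<Rightarrow> 'v set set set" where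
  "Sd K = {c. subset.chain K c \<and> finite c \<and> c \<noteq> {}}"

definition subdivision_filtration :: "'v set set \<Rightarrow> real \<Rightarrow> 'v set set set" where
  "subdivision_filtration K m =
     {c \<in> Sd K. \<exists>\<sigma>\<^sub>0\<in>c. (\<forall>\<sigma>\<in>c. \<sigma>\<^sub>0 \<subseteq> \<sigma>) \<and> m - 1 \<le> real_of_int (simplex_dim \<sigma>\<^sub>0)}"

lemma abstract_complex_dowker_weight: "abstract_complex (dowker_weight X Y R m)"
  unfolding abstract_complex_def
proof (intro ballI conjI allI impI)
  fix \<sigma> assume \<sigma>: "\<sigma> \<in> dowker_weight X Y R m"
  then show "finite \<sigma>" "\<sigma> \<noteq> {}" by (auto simp: dowker_weight_def dowker_def)
  fix \<tau> assume \<tau>: "\<tau> \<subseteq> \<sigma> \<and> \<tau> \<noteq> {}"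
  have sub: "{y\<in>Y. \<sigma> \<times> {y} \<subseteq> R} \<subseteq> {y\<in>Y. \<tau> \<times> {y} \<subseteq> R}" using \<tau> by blast
  have "total_weight Y R \<sigma> \<le> total_weight Y R \<tau>"
    using sub finite_subset[OF sub] by (auto simp: total_weight_def Let_def card_mono)
  then have "ereal_of_enat (total_weight Y R \<sigma>) \<le> ereal_of_enat (total_weight Y R \<tau>)"
    by simp
  moreover have "\<tau> \<in> dowker X Y R"
  proof -
    from \<sigma> obtain y where "y \<in> Y" "\<sigma> \<times> {y} \<subseteq> R" "\<sigma> \<subseteq> X" "finite \<sigma>"
      unfolding dowker_weight_def dowker_def by blast
    moreover from this have "\<tau> \<times> {y} \<subseteq> R" "\<tau> \<subseteq> X" "finite \<tau>"
      using \<tau> by (auto intro: finite_subset)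
    ultimately show ?thesis
      using \<tau> unfolding dowker_def by blast
  qed
  ultimately show "\<tau> \<in> dowker_weight X Y R m"
    using \<sigma> unfolding dowker_weight_def by (auto intro: order_trans)
qed

lemma abstract_complex_subdivision_filtration:
  assumes "abstract_complex K"
  shows "abstract_complex (subdivision_filtration K m)"
  unfolding abstract_complex_def
proof (intro ballI conjI allI impI)
  fix c assume c: "c \<in> subdivision_filtration K m"
  then show "finite c" "c \<noteq> {}" by (auto simp: subdivision_filtration_def Sd_def)
  fix d assume d: "d \<subseteq> c \<and> d \<noteq> {}"
  have chain: "subset.chain K d" "finite d"
    using c d unfolding subdivision_filtration_def Sd_def subset_chain_def
    by (simp_all add: subset_iff) (metis finite_subset subsetI)
  then have in_d: "\<Inter>d \<in> d" and "d \<in> Sd K"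
    using d Inter_in_chain[of d K] by (auto simp: Sd_def)
  obtain \<sigma>\<^sub>0 where \<sigma>\<^sub>0: "\<forall>\<sigma>\<in>c. \<sigma>\<^sub>0 \<subseteq> \<sigma>" "m - 1 \<le> real_of_int (simplex_dim \<sigma>\<^sub>0)"
    using c unfolding subdivision_filtration_def by blast
  have "finite (\<Inter>d)"
    using chain in_d assms unfolding subset_chain_def abstract_complex_def by blast
  moreover have "\<sigma>\<^sub>0 \<subseteq> \<Inter>d"
    using \<sigma>\<^sub>0 d by blast
  ultimately have "card \<sigma>\<^sub>0 \<le> card (\<Inter>d)"
    by (rule card_mono)
  then have "m - 1 \<le> real_of_int (simplex_dim (\<Inter>d))"
    using \<sigma>\<^sub>0(2) by (simp add: simplex_dim_def)
  moreover have "\<forall>\<sigma>\<in>d. \<Inter>d \<subseteq> \<sigma>" by blast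
  ultimately show "d \<in> subdivision_filtration K m"
    using in_d \<open>d \<in> Sd K\<close> unfolding subdivision_filtration_def by blast
qed


section \<open>Compactly generated weakly Hausdorff spaces\<close>

text \<open>The test spaces range over all compact Hausdorff topologies on subsets of the type
  \<open>'a set set\<close>. This is no restriction on the conjunction of the two conditions: given
  \<open>u : K \<rightarrow> X\<close> with \<open>K\<close> compact Hausdorff, pick one preimage of each point of \<open>u ` K\<close>;
  the closure of these preimages in \<open>K\<close> is compact Hausdorff, has the same image, and has
  cardinality at most that of \<open>'a set set\<close>, being Hausdorff with a dense subset no larger than \<open>X\<close>.
  In a weakly Hausdorff space \<open>u ` K\<close> is itself compact Hausdorff, so that inclusions
  of such subspaces suffice to test for closed subsets.\<close>

definition weakly_Hausdorff_space :: "'a topology \<Rightarrow> bool" where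
  "weakly_Hausdorff_space X \<longleftrightarrow>
     (\<forall>(K :: 'a set set topology) u.
        compact_space K \<and> Hausdorff_space K \<and> continuous_map K X u
        \<longrightarrow> closedin X (u ` topspace K))"

definition compactly_generated_space :: "'a topology \<Rightarrow> bool" where
  "compactly_generated_space X \<longleftrightarrow>
     (\<forall>A \<subseteq> topspace X.
        (\<forall>(K :: 'a set set topology) u.
           compact_space K \<and> Hausdorff_space K \<and> continuous_map K X u
           \<longrightarrow> closedin K {k \<in> topspace K. u k \<in> A})
        \<longrightarrow> closedin X A)"

definition CGWH :: "'a topology \<Rightarrow> bool" where
  "CGWH X \<longleftrightarrow> compactly_generated_space X \<and> weakly_Hausdorff_space X"


section \<open>Filtrations and weak equivalence\<close>

text \<open>A poset is given by its carrier \<open>P\<close> and its order relation \<open>le\<close>. Since all morphisms are sent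
  to inclusions of subspaces, a filtration amounts to its values on objects; the values
  outside \<open>P\<close> are irrelevant.\<close>

definition filtration :: "'p set \<Rightarrow> ('p \<Rightarrow> 'p \<Rightarrow> bool) \<Rightarrow> ('p \<Rightarrow> 'a topology) \<Rightarrow> bool" where
  "filtration P le F \<longleftrightarrow>
     (\<forall>p\<in>P. CGWH (F p)) \<and>
     (\<forall>p\<in>P. \<forall>q\<in>P. le p q \<longrightarrow>
        topspace (F p) \<subseteq> topspace (F q) \<and> F p = subtopology (F q) (topspace (F p)))"

definition homotopy_equivalence_map :: "'a topology \<Rightarrow> 'b topology \<Rightarrow> ('a \<Rightarrow> 'b) \<Rightarrow> bool" where
  "homotopy_equivalence_map X Y f \<longleftrightarrow> continuous_map X Y f \<and>
     (\<exists>g. continuous_map Y X g \<and>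
          homotopic_with (\<lambda>_. True) X X (g \<circ> f) id \<and>
          homotopic_with (\<lambda>_. True) Y Y (f \<circ> g) id)"

definition objectwise_equivalence ::
    "'p set \<Rightarrow> ('p \<Rightarrow> 'p \<Rightarrow> bool) \<Rightarrow> ('p \<Rightarrow> 'a topology) \<Rightarrow> ('p \<Rightarrow> 'b topology)
      \<Rightarrow> ('p \<Rightarrow> 'a \<Rightarrow> 'b) \<Rightarrow> bool" where
  "objectwise_equivalence P le F G h \<longleftrightarrow>
     filtration P le F \<and> filtration P le G \<and>
     (\<forall>p\<in>P. homotopy_equivalence_map (F p) (G p) (h p)) \<and>
     (\<forall>p\<in>P. \<forall>q\<in>P. le p q \<longrightarrow> (\<forall>x\<in>topspace (F p). h q x = h p x))"

definition objectwise_equivalent ::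
    "'p set \<Rightarrow> ('p \<Rightarrow> 'p \<Rightarrow> bool) \<Rightarrow> ('p \<Rightarrow> 'a topology) \<Rightarrow> ('p \<Rightarrow> 'b topology) \<Rightarrow> bool" where
  "objectwise_equivalent P le F G \<longleftrightarrow>
     (\<exists>h. objectwise_equivalence P le F G h) \<or> (\<exists>h. objectwise_equivalence P le G F h)"

text \<open>HOL cannot quantify over the carrier types of the intermediate filtrations
  \<open>H, \<dots>, H'\<close> of a zig-zag, so their common carrier type \<open>'c\<close> is a parameter. A weak
  equivalence in this sense, for whichever \<open>'c\<close>, is a weak equivalence in the usual one.\<close>

definition weakly_equivalent ::
    "'c itself \<Rightarrow> 'p set \<Rightarrow> ('p \<Rightarrow> 'p \<Rightarrow> bool) \<Rightarrow> ('p \<Rightarrow> 'a topology) \<Rightarrow> ('p \<Rightarrow> 'b topology)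
      \<Rightarrow> bool" where
  "weakly_equivalent (_ :: 'c itself) P le F G \<longleftrightarrow>
     (\<exists>H H' :: 'p \<Rightarrow> 'c topology.
        objectwise_equivalent P le F H \<and>
        (objectwise_equivalent P le)\<^sup>*\<^sup>* H H' \<and>
        objectwise_equivalent P le H' G)"

end

theory Submission
  imports Defs
begin

text \<open>
For a fixed weight \<open>m\<close> and relation \<open>R\<close>, call a pair \<open>(\<sigma>, \<tau>)\<close> of non-empty finite sets with
\<open>\<sigma> \<times> \<tau> \<subseteq> R\<close> and \<open>m \<le> card \<tau>\<close> a rectangle. The first sides of rectangles are exactly the simplices of
the Dowker complex of weight at least \<open>m\<close>: a simplex has weight at least \<open>m\<close> iff some finite set of at least
\<open>m\<close> elements witnesses it. The second sides are the simplices with at least \<open>m\<close> vertices of the Dowker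
complex of the transpose, and flags of these are what the subdivision filtration consists of. So
both filtrations are compared with the order complex of the poset of rectangles: projection to the
second side is a simplicial map to the subdivision filtration, and projection to the first side,
followed by the map sending a simplex to its barycentre, goes to the Dowker complex. Neither map
depends on \<open>m\<close> or \<open>R\<close>, so both are natural, and it remains to see that each of them
is a homotopy equivalence for every single \<open>m\<close> and \<open>R\<close>.

This is an instance of Quillen's fibre theorem, for which an explicit homotopy inverse exists here.
Order the rectangles by \<open>(\<sigma>, \<tau>) \<le> (\<sigma>', \<tau>')\<close> iff \<open>\<sigma>' \<subseteq> \<sigma>\<close> and \<open>\<tau> \<subseteq> \<tau>'\<close>, and choose for each first side \<open>\<sigma>\<close> a
second side \<open>w \<sigma>\<close>. A flag \<open>c\<close> of first sides has a smallest member \<open>\<Inter>c\<close>, which forms a rectangle with the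
union of all the \<open>w \<sigma>\<close> for \<open>\<sigma> \<in> c\<close>; when the flag grows, the first side shrinks and the second one grows. Thus
flags map monotonically to rectangles, and barycentric subdivision turns this into a map from
the order complex of first sides to the order complex of rectangles. Both composites are homotopic to the
identity, through maps that are either contiguous (\<open>homotopic_contiguous\<close>) or induced by
comparable monotone maps (\<open>homotopic_simplicial_mono\<close>). The argument is carried out in
\<open>fibre_homotopy_equivalence\<close> for posets. It applies to both projections, because exchanging
the two sides merely reverses the order on rectangles and so leaves its order complex unchanged.

Since the complexes may be infinite, the coherent topology needs some care. Continuity of a map out of a
realization, or of a homotopy, is tested on closed cells (\<open>continuous_map_from_realization\<close>,
\<open>continuous_map_from_realization_prod\<close>); a map into a realization whose values are supported in a common finite set
is continuous as soon as its coordinates are (\<open>continuous_map_into_realization\<close>), and compact sets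
always have such a common support (\<open>compactin_realization_finite_supp\<close>).
\<close>

section \<open>The topology of a realization\<close>

definition supp :: "('v \<Rightarrow> real) \<Rightarrow> 'v set" where
  "supp x = {v. x v \<noteq> 0}"

lemma abstract_complexD:
  assumes "abstract_complex K" "\<sigma> \<in> K"
  shows "finite \<sigma>" "\<sigma> \<noteq> {}" "\<And>\<tau>. \<tau> \<subseteq> \<sigma> \<Longrightarrow> \<tau> \<noteq> {} \<Longrightarrow> \<tau> \<in> K"
  using assms unfolding abstract_complex_def by blast+

lemma sum_supp:
  assumes "finite S" "supp x \<subseteq> S"
  shows "sum x (supp x) = sum x S"
  by (rule sum.mono_neutral_left) (use assms in \<open>auto simp: supp_def\<close>)

lemma closed_cell_iff:
  assumes "finite \<sigma>"
  shows "x \<in> closed_cell \<sigma> \<longleftrightarrow> (\<forall>v. 0 \<le> x v) \<and> supp x \<subseteq> \<sigma> \<and> sum x (supp x) = 1"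
proof -
  have "supp x \<subseteq> \<sigma> \<longleftrightarrow> (\<forall>v. v \<notin> \<sigma> \<longrightarrow> x v = 0)"
    by (auto simp: supp_def)
  then show ?thesis
    using sum_supp[OF assms, of x] by (auto simp: closed_cell_def)
qed

lemma closed_cell_le_one:
  assumes "finite \<sigma>" "x \<in> closed_cell \<sigma>"
  shows "x v \<le> 1"
proof (cases "v \<in> \<sigma>")
  case True
  with assms show ?thesis
    using member_le_sum[of v \<sigma> x] by (auto simp: closed_cell_def)
qed (use assms in \<open>auto simp: closed_cell_def\<close>)

lemma topspace_realization: "topspace (realization K) = (\<Union>\<sigma>\<in>K. closed_cell \<sigma>)"
proof (rule antisym)
  show "topspace (realization K) \<subseteq> (\<Union>\<sigma>\<in>K. closed_cell \<sigma>)"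
    using openin_topspace[of "realization K"] unfolding openin_realization by blast
  have "openin (realization K) (\<Union>\<sigma>\<in>K. closed_cell \<sigma>)"
    unfolding openin_realization by (auto simp: Int_absorb1 UN_upper)
  then show "(\<Union>\<sigma>\<in>K. closed_cell \<sigma>) \<subseteq> topspace (realization K)"
    by (rule openin_subset)
qed

lemma in_realization_iff:
  assumes "abstract_complex K"
  shows "x \<in> topspace (realization K) \<longleftrightarrow>
    (\<forall>v. 0 \<le> x v) \<and> supp x \<in> K \<and> sum x (supp x) = 1"
proof
  assume "x \<in> topspace (realization K)"
  then obtain \<sigma> where \<sigma>: "\<sigma> \<in> K" "x \<in> closed_cell \<sigma>"
    by (auto simp: topspace_realization)
  then have "(\<forall>v. 0 \<le> x v) \<and> supp x \<subseteq> \<sigma> \<and> sum x (supp x) = 1"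
    using closed_cell_iff abstract_complexD(1)[OF assms] by blast
  then show "(\<forall>v. 0 \<le> x v) \<and> supp x \<in> K \<and> sum x (supp x) = 1"
    using abstract_complexD(3)[OF assms \<sigma>(1), of "supp x"] by fastforce
next
  assume x: "(\<forall>v. 0 \<le> x v) \<and> supp x \<in> K \<and> sum x (supp x) = 1"
  then have "x \<in> closed_cell (supp x)"
    using closed_cell_iff abstract_complexD(1)[OF assms] by blast
  with x show "x \<in> topspace (realization K)"
    by (auto simp: topspace_realization)
qed

lemma realization_finite_supp:
  "abstract_complex K \<Longrightarrow> x \<in> topspace (realization K) \<Longrightarrow> finite (supp x)"
  by (simp add: in_realization_iff abstract_complexD(1))

lemma closed_closed_cell:
  assumes "finite (\<sigma> :: 'v set)"
  shows "closed (closed_cell \<sigma>)"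
proof -
  have *: "continuous_on UNIV (\<lambda>x :: 'v \<Rightarrow> real. x v)" for v
    by (rule continuous_on_product_then_coordinatewise) simp
  have "closed_cell \<sigma> = (\<Inter>v. {x. 0 \<le> x v}) \<inter> (\<Inter>v\<in>-\<sigma>. {x. x v = 0}) \<inter> {x. sum x \<sigma> = 1}"
    by (auto simp: closed_cell_def)
  also have "closed \<dots>"
    by (intro closed_Int closed_INT ballI closed_Collect_le closed_Collect_eq
        continuous_on_sum continuous_on_const *)
  finally show ?thesis .
qed

lemma compact_closed_cell:
  assumes "finite (\<sigma> :: 'v set)"
  shows "compact (closed_cell \<sigma>)"
proof -
  have "compactin (product_topology (\<lambda>_ :: 'v. euclideanreal) UNIV) (PiE UNIV (\<lambda>_. {0..1}))"
    by (simp add: compactin_PiE)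
  then have "compact (PiE (UNIV :: 'v set) (\<lambda>_. {0..1 :: real}))"
    by (simp add: euclidean_product_topology)
  moreover have "closed_cell \<sigma> \<subseteq> PiE UNIV (\<lambda>_. {0..1})"
    using closed_cell_le_one[OF assms] by (auto simp: closed_cell_def)
  ultimately show ?thesis
    using closed_closed_cell[OF assms] compact_Int_closed[of _ "closed_cell \<sigma>"]
    by (metis inf.absorb2)
qed

lemma closedin_realization:
  assumes "abstract_complex K"
  shows "closedin (realization K) C \<longleftrightarrow>
    C \<subseteq> topspace (realization K) \<and> (\<forall>\<sigma>\<in>K. closed (C \<inter> closed_cell \<sigma>))"
proof -
  have "openin (top_of_set (closed_cell \<sigma>)) ((topspace (realization K) - C) \<inter> closed_cell \<sigma>)
    \<longleftrightarrow> closed (C \<inter> closed_cell \<sigma>)" if "\<sigma> \<in> K" for \<sigma>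
  proof -
    have "(topspace (realization K) - C) \<inter> closed_cell \<sigma> = closed_cell \<sigma> - (C \<inter> closed_cell \<sigma>)"
      using that by (auto simp: topspace_realization)
    moreover have "openin (top_of_set (closed_cell \<sigma>)) (closed_cell \<sigma> - (C \<inter> closed_cell \<sigma>))
      \<longleftrightarrow> closedin (top_of_set (closed_cell \<sigma>)) (C \<inter> closed_cell \<sigma>)"
      by (simp add: closedin_def)
    moreover have "\<dots> \<longleftrightarrow> closed (C \<inter> closed_cell \<sigma>)"
      using closed_closed_cell[OF abstract_complexD(1)[OF assms that]]
      by (simp add: closedin_closed_eq)
    ultimately show ?thesis by simp
  qed
  then show ?thesis
    unfolding closedin_def[of "realization K"] openin_realization[of K "_ - _"]
    by (auto simp flip: topspace_realization)
qed

text \<open>A realized complex meets the closed cell of an arbitrary finite vertex set in finitely many of its own closed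
cells, so a closed set stays closed when it is cut down to a cell that is not part of the complex.\<close>
lemma closedin_realization_Int_cell:
  assumes "abstract_complex K" "finite \<sigma>" "closedin (realization K) C"
  shows "closed (C \<inter> closed_cell \<sigma>)"
proof -
  have "C \<inter> closed_cell \<sigma> = (\<Union>\<tau>\<in>{\<tau>\<in>K. \<tau> \<subseteq> \<sigma>}. C \<inter> closed_cell \<tau>)" (is "_ = ?R")
  proof
    show "C \<inter> closed_cell \<sigma> \<subseteq> ?R"
    proof
      fix x assume x: "x \<in> C \<inter> closed_cell \<sigma>"
      then have "supp x \<subseteq> \<sigma>" "supp x \<in> K" "x \<in> closed_cell (supp x)"
        using assms closedin_subset[OF assms(3)] finite_subset[of "supp x" \<sigma>]
        by (auto simp: closed_cell_iff in_realization_iff)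
      with x show "x \<in> ?R" by blast
    qed
    show "?R \<subseteq> C \<inter> closed_cell \<sigma>"
    proof
      fix x assume "x \<in> ?R"
      then obtain \<tau> where "x \<in> C" "\<tau> \<in> K" "\<tau> \<subseteq> \<sigma>" "x \<in> closed_cell \<tau>" by blast
      then show "x \<in> C \<inter> closed_cell \<sigma>"
        using assms abstract_complexD(1)[OF assms(1), of \<tau>] by (auto simp: closed_cell_iff)
    qed
  qed
  also have "closed ?R"
    by (rule closed_UN)
      (use assms in \<open>auto simp: closedin_realization intro: finite_subset[of _ "Pow \<sigma>"]\<close>)
  finally show ?thesis .
qed

lemma continuous_map_from_realization:
  assumes "\<And>\<sigma>. \<sigma> \<in> K \<Longrightarrow> continuous_map (top_of_set (closed_cell \<sigma>)) Y f"
  shows "continuous_map (realization K) Y f"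
  unfolding continuous_map_def
proof (intro conjI allI impI)
  show "f \<in> topspace (realization K) \<rightarrow> topspace Y"
    using assms by (fastforce simp: topspace_realization continuous_map_def)
  fix U assume U: "openin Y U"
  have "{x \<in> topspace (realization K). f x \<in> U} \<inter> closed_cell \<sigma> = {x \<in> closed_cell \<sigma>. f x \<in> U}"
    if "\<sigma> \<in> K" for \<sigma>
    using that by (auto simp: topspace_realization)
  moreover have "openin (top_of_set (closed_cell \<sigma>)) {x \<in> closed_cell \<sigma>. f x \<in> U}" if "\<sigma> \<in> K" for \<sigma>
    using openin_continuous_map_preimage[OF assms[OF that] U] by simp
  ultimately show "openin (realization K) {x \<in> topspace (realization K). f x \<in> U}"
    unfolding openin_realization[of K] by (auto simp: topspace_realization)
qed

lemma continuous_map_coordinate: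
  "continuous_map (realization K) euclideanreal (\<lambda>x. x v)"
proof (rule continuous_map_from_realization)
  fix \<sigma>
  have "continuous_on (closed_cell \<sigma>) (\<lambda>x. x v)"
    by (rule continuous_on_product_then_coordinatewise) simp
  then show "continuous_map (top_of_set (closed_cell \<sigma>)) euclideanreal (\<lambda>x. x v)"
    by simp
qed

text \<open>Distinct points differ in some barycentric coordinate, and coordinates are continuous.\<close>
lemma Hausdorff_realization: "Hausdorff_space (realization K)"
  unfolding Hausdorff_space_def
proof (intro allI impI)
  fix x y assume xy: "x \<in> topspace (realization K) \<and> y \<in> topspace (realization K) \<and> x \<noteq> y"
  then obtain v where "x v \<noteq> y v" by blast
  then obtain U V where UV: "open U" "open V" "x v \<in> U" "y v \<in> V" "U \<inter> V = {}"
    by (metis hausdorff)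
  let ?P = "\<lambda>U. {z \<in> topspace (realization K). z v \<in> U}"
  have "openin (realization K) (?P U)" "openin (realization K) (?P V)"
    using openin_continuous_map_preimage[OF continuous_map_coordinate] UV by auto
  moreover have "disjnt (?P U) (?P V)"
    using UV by (auto simp: disjnt_def)
  ultimately show "\<exists>U V. openin (realization K) U \<and> openin (realization K) V \<and> x \<in> U \<and> y \<in> V \<and> disjnt U V"
    using xy UV by blast
qed

text \<open>On the cells spanned by a finite vertex set the coherent topology is that of pointwise convergence, and these
cells form a closed subset; this is what makes continuity a matter of coordinates.\<close>
lemma continuous_map_into_realization:
  assumes L: "abstract_complex L" and S: "finite S"
    and in_L: "\<And>a. a \<in> topspace A \<Longrightarrow> f a \<in> topspace (realization L)"
    and supp: "\<And>a. a \<in> topspace A \<Longrightarrow> supp (f a) \<subseteq> S"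
    and cont: "\<And>v. v \<in> S \<Longrightarrow> continuous_map A euclideanreal (\<lambda>a. f a v)"
  shows "continuous_map A (realization L) f"
  unfolding continuous_map_closedin
proof (intro conjI allI impI)
  show "f \<in> topspace A \<rightarrow> topspace (realization L)"
    using in_L by blast
  have coord: "continuous_map A euclideanreal (\<lambda>a. f a v)" for v
  proof (cases "v \<in> S")
    case False
    then have "f a v = 0" if "a \<in> topspace A" for a
      using supp[OF that] by (auto simp: supp_def)
    then show ?thesis
      using continuous_map_eq[of A euclideanreal "\<lambda>_. 0"] by auto
  qed (rule cont)
  then have "continuous_map A (product_topology (\<lambda>_. euclideanreal) UNIV) f"
    by (simp add: continuous_map_componentwise_UNIV)
  then have f: "continuous_map A euclidean f"
    by (simp add: euclidean_product_topology)
  fix C assume C: "closedin (realization L) C"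
  have "{a \<in> topspace A. f a \<in> C} = {a \<in> topspace A. f a \<in> C \<inter> closed_cell S}"
    using in_L supp S L by (auto simp: closed_cell_iff in_realization_iff)
  moreover have "closedin A \<dots>"
    using closedin_continuous_map_preimage[OF f, of "C \<inter> closed_cell S"]
      closedin_realization_Int_cell[OF L S C] by (simp only: closed_closedin)
  ultimately show "closedin A {a \<in> topspace A. f a \<in> C}" by simp
qed

text \<open>A realization is a quotient of the disjoint union of its closed cells, and the product of a quotient map with a
locally compact Hausdorff space is again a quotient map. With the unit interval in the role of \<open>Z\<close>, this
is the test for the continuity of homotopies.\<close>
lemma continuous_map_from_realization_prod:
  assumes Z: "locally_compact_space Z" "Hausdorff_space Z"
    and h: "\<And>\<sigma>. \<sigma> \<in> K \<Longrightarrow> continuous_map (prod_topology Z (top_of_set (closed_cell \<sigma>))) Y h"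
  shows "continuous_map (prod_topology Z (realization K)) Y h"
proof -
  define S where "S = sum_topology (\<lambda>\<sigma>. top_of_set (closed_cell \<sigma>)) K"
  have topS: "topspace S = Sigma K closed_cell"
    by (auto simp: S_def)
  have q: "quotient_map S (realization K) snd"
    unfolding quotient_map_def
  proof (intro conjI allI impI)
    show "snd ` topspace S = topspace (realization K)"
      by (force simp: topS topspace_realization)
    fix U assume U: "U \<subseteq> topspace (realization K)"
    have "{x. (\<sigma>, x) \<in> {z \<in> topspace S. snd z \<in> U}} = U \<inter> closed_cell \<sigma>" if "\<sigma> \<in> K" for \<sigma>
      using that by (auto simp: topS)
    then show "openin S {z \<in> topspace S. snd z \<in> U} \<longleftrightarrow> openin (realization K) U"
      using U unfolding S_def openin_sum_topology openin_realization topspace_realization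
      by (auto simp: S_def[symmetric] topS)
  qed
  have "continuous_map (prod_topology Z S) Y (h \<circ> (\<lambda>(z, p). (z, snd p)))"
    unfolding continuous_map_def
  proof (intro conjI allI impI)
    show "h \<circ> (\<lambda>(z, p). (z, snd p)) \<in> topspace (prod_topology Z S) \<rightarrow> topspace Y"
      using h by (fastforce simp: topS continuous_map_def)
    fix U assume U: "openin Y U"
    let ?P = "{w \<in> topspace (prod_topology Z S). (h \<circ> (\<lambda>(z, p). (z, snd p))) w \<in> U}"
    show "openin (prod_topology Z S) ?P"
      unfolding openin_prod_topology_alt
    proof (intro allI impI)
      fix z p assume zp: "(z, p) \<in> ?P"
      then obtain \<sigma> x where p: "p = (\<sigma>, x)" "\<sigma> \<in> K" "x \<in> closed_cell \<sigma>" "z \<in> topspace Z"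
        by (auto simp: topS)
      have "openin (prod_topology Z (top_of_set (closed_cell \<sigma>)))
          {w \<in> topspace (prod_topology Z (top_of_set (closed_cell \<sigma>))). h w \<in> U}"
        by (rule openin_continuous_map_preimage[OF h[OF p(2)] U])
      moreover have "(z, x) \<in> {w \<in> topspace (prod_topology Z (top_of_set (closed_cell \<sigma>))). h w \<in> U}"
        using p zp by auto
      ultimately obtain V W where VW: "openin Z V" "openin (top_of_set (closed_cell \<sigma>)) W" "z \<in> V" "x \<in> W"
        "V \<times> W \<subseteq> {w \<in> topspace (prod_topology Z (top_of_set (closed_cell \<sigma>))). h w \<in> U}"
        unfolding openin_prod_topology_alt by meson
      have "openin S (Pair \<sigma> ` W)"
        using open_map_component_injection[OF p(2), of "\<lambda>\<sigma>. top_of_set (closed_cell \<sigma>)"] VW(2)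
        unfolding S_def open_map_def by blast
      moreover have "V \<times> Pair \<sigma> ` W \<subseteq> ?P"
        using VW(5) p(2) by (auto simp: topS)
      ultimately show "\<exists>V W. openin Z V \<and> openin S W \<and> z \<in> V \<and> p \<in> W \<and> V \<times> W \<subseteq> ?P"
        using VW p by blast
    qed
  qed
  then show ?thesis
    using quotient_map_prod_right[OF Z(1) _ q] Z(2)
    by (metis continuous_compose_quotient_map)
qed

text \<open>Pick for every vertex \<open>v\<close> in the support a point of \<open>C\<close> whose coordinate at \<open>v\<close> is non-zero. A closed cell
contains only finitely many of the chosen points, so every set of chosen points is closed. The
chosen points therefore form a closed discrete subset of a compact set, which is finite.\<close>
lemma compactin_realization_finite_supp:
  assumes L: "abstract_complex L" and C: "compactin (realization L) C"
  shows "finite (\<Union>x\<in>C. supp x)"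
proof -
  define V where "V = (\<Union>x\<in>C. supp x)"
  have C_sub: "C \<subseteq> topspace (realization L)"
    using C by (rule compactin_subset_topspace)
  have "\<forall>v\<in>V. \<exists>x\<in>C. v \<in> supp x"
    by (simp add: V_def)
  then obtain p where p: "\<And>v. v \<in> V \<Longrightarrow> p v \<in> C \<and> v \<in> supp (p v)"
    by metis
  have closed: "closedin (realization L) E" if "E \<subseteq> p ` V" for E
    unfolding closedin_realization[OF L]
  proof (intro conjI ballI)
    show "E \<subseteq> topspace (realization L)" using that p C_sub by blast
    fix \<sigma> assume \<sigma>: "\<sigma> \<in> L"
    have "E \<inter> closed_cell \<sigma> \<subseteq> p ` \<sigma>"
    proof
      fix x assume x: "x \<in> E \<inter> closed_cell \<sigma>"
      from x that have "x \<in> p ` V" by (metis IntD1 subsetD)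
      then obtain v where v: "v \<in> V" "x = p v" by (rule imageE)
      then have "v \<in> \<sigma>"
        using p[OF v(1)] x closed_cell_iff[OF abstract_complexD(1)[OF L \<sigma>], of x] by blast
      then show "x \<in> p ` \<sigma>" using v by blast
    qed
    then have "finite (E \<inter> closed_cell \<sigma>)"
      using abstract_complexD(1)[OF L \<sigma>] finite_subset by blast
    then have "closedin (realization L) (E \<inter> closed_cell \<sigma>)"
      using Hausdorff_imp_t1_space[OF Hausdorff_realization, of L] \<open>E \<subseteq> topspace (realization L)\<close>
      unfolding t1_space_closedin_finite by blast
    then show "closed (E \<inter> closed_cell \<sigma>)"
      using closedin_realization_Int_cell[OF L abstract_complexD(1)[OF L \<sigma>]] by force
  qed
  have "p ` V \<subseteq> C" using p by blast
  then have "compactin (realization L) (p ` V)"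
    using closed_compactin[OF C _ closed[OF order_refl]] by blast
  moreover have "subtopology (realization L) (p ` V) = discrete_topology (p ` V)"
  proof -
    have "openin (subtopology (realization L) (p ` V)) {x}" if x: "x \<in> p ` V" for x
    proof -
      have "{x} = (topspace (realization L) - (p ` V - {x})) \<inter> p ` V"
        using x \<open>p ` V \<subseteq> C\<close> C_sub by blast
      then show ?thesis
        unfolding openin_subtopology using closed[of "p ` V - {x}"] by blast
    qed
    then show ?thesis
      using discrete_topology_unique[of "p ` V"] \<open>p ` V \<subseteq> C\<close> C_sub
      by (metis inf.absorb2 order_trans topspace_subtopology)
  qed
  ultimately have "finite (p ` V)"
    by (metis compactin_subspace compact_space_discrete_topology)
  then have "finite (\<Union>x\<in>p ` V. supp x)"
    using realization_finite_supp[OF L] C_sub \<open>p ` V \<subseteq> C\<close> by blast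
  moreover have "V \<subseteq> (\<Union>x\<in>p ` V. supp x)" using p by blast
  ultimately show ?thesis 
    using finite_subset unfolding V_def by blast
qed

lemma continuous_map_cell_inclusion:
  assumes K: "abstract_complex K" and \<sigma>: "\<sigma> \<in> K"
  shows "continuous_map (top_of_set (closed_cell \<sigma>)) (realization K) (\<lambda>x. x)"
proof (rule continuous_map_into_realization[OF K abstract_complexD(1)[OF K \<sigma>]])
  fix a assume a: "a \<in> topspace (top_of_set (closed_cell \<sigma>))"
  then show "a \<in> topspace (realization K)"
    using \<sigma> by (auto simp: topspace_realization)
  show "supp a \<subseteq> \<sigma>"
    using a closed_cell_iff[OF abstract_complexD(1)[OF K \<sigma>]] by auto
next
  fix v
  have "continuous_on (closed_cell \<sigma>) (\<lambda>x. x v)"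
    by (rule continuous_on_product_then_coordinatewise) simp
  then show "continuous_map (top_of_set (closed_cell \<sigma>)) euclideanreal (\<lambda>x. x v)"
    by simp
qed

lemma compactin_cell:
  assumes "abstract_complex K" "\<sigma> \<in> K"
  shows "compactin (realization K) (closed_cell \<sigma>)"
  using image_compactin[OF _ continuous_map_cell_inclusion[OF assms], of "closed_cell \<sigma>"]
    compact_closed_cell[OF abstract_complexD(1)[OF assms]]
  by (simp add: compactin_subtopology)

text \<open>Weak Hausdorffness follows from Hausdorffness. As closedness is tested on closed cells, which are compact
Hausdorff, the closed cells are enough as test spaces for compact generation.\<close>
lemma CGWH_realization:
  assumes K: "abstract_complex (K :: 'v set set)"
  shows "CGWH (realization K)"
  unfolding CGWH_def
proof
  show "weakly_Hausdorff_space (realization K)"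
    unfolding weakly_Hausdorff_space_def
    by (meson Hausdorff_realization compactin_imp_closedin compact_space_def image_compactin)
  show "compactly_generated_space (realization K)"
    unfolding compactly_generated_space_def
  proof (intro allI impI)
    fix A
    assume A: "A \<subseteq> topspace (realization K)"
      and test: "\<forall>(T :: ('v \<Rightarrow> real) set set topology) u.
        compact_space T \<and> Hausdorff_space T \<and> continuous_map T (realization K) u
        \<longrightarrow> closedin T {k \<in> topspace T. u k \<in> A}"
    show "closedin (realization K) A"
      unfolding closedin_realization[OF K]
    proof (intro conjI ballI A)
      fix \<sigma> assume \<sigma>: "\<sigma> \<in> K"
      let ?C = "top_of_set (closed_cell \<sigma>)"
      \<comment> \<open>A copy of the closed cell in the type prescribed for test spaces.\<close>
      define j :: "('v \<Rightarrow> real) \<Rightarrow> ('v \<Rightarrow> real) set set" where "j x = {{x}}" for x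
      define u :: "('v \<Rightarrow> real) set set \<Rightarrow> 'v \<Rightarrow> real" where "u k = the_elem (the_elem k)" for k
      have uj [simp]: "u (j x) = x" for x
        by (simp add: u_def j_def)
      define T where "T = pullback_topology (j ` closed_cell \<sigma>) u ?C"
      have topT: "topspace T = j ` closed_cell \<sigma>"
        unfolding T_def topspace_pullback_topology by auto
      have u: "continuous_map T ?C u"
        using continuous_map_pullback[OF continuous_map_id, of "j ` closed_cell \<sigma>" u ?C]
        by (simp add: T_def)
      have j: "continuous_map ?C T j"
        unfolding T_def by (rule continuous_map_pullback') (auto simp: o_def)
      have "homeomorphic_maps ?C T j u"
        using u j topT by (auto simp: homeomorphic_maps_def)
      then have hom: "?C homeomorphic_space T"
        unfolding homeomorphic_space_def by blast
      have "compact_space T"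
        using homeomorphic_compact_space[OF hom] compact_closed_cell[OF abstract_complexD(1)[OF K \<sigma>]]
        by (simp add: compact_space_subtopology)
      moreover have "Hausdorff_space ?C"
        using Hausdorff_space_subtopology[of euclidean "closed_cell \<sigma>"]
        by (metis Hausdorff_realization Hausdorff_space_def continuous_map_cell_inclusion[OF K \<sigma>]
            Hausdorff_space_injective_preimage inj_on_def)
      then have "Hausdorff_space T"
        using homeomorphic_Hausdorff_space[OF hom] by simp
      moreover have "continuous_map T (realization K) u"
        using continuous_map_compose[OF u continuous_map_cell_inclusion[OF K \<sigma>]] by (simp add: o_def)
      ultimately have "closedin T {k \<in> topspace T. u k \<in> A}"
        using test by blast
      then have "closedin ?C {x \<in> topspace ?C. j x \<in> {k \<in> topspace T. u k \<in> A}}"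
        by (rule closedin_continuous_map_preimage[OF j])
      moreover have "{x \<in> topspace ?C. j x \<in> {k \<in> topspace T. u k \<in> A}} = A \<inter> closed_cell \<sigma>"
        by (auto simp: topT)
      ultimately show "closed (A \<inter> closed_cell \<sigma>)"
        using closed_closed_cell[OF abstract_complexD(1)[OF K \<sigma>]] by (simp add: closedin_closed_eq)
    qed
  qed
qed

lemma realization_subcomplex:
  assumes K: "abstract_complex K" and L: "abstract_complex L" and KL: "K \<subseteq> L"
  shows "topspace (realization K) \<subseteq> topspace (realization L)"
    and "realization K = subtopology (realization L) (topspace (realization K))"
proof -
  show top: "topspace (realization K) \<subseteq> topspace (realization L)"
    using KL by (auto simp: topspace_realization)
  have "closedin (realization K) C \<longleftrightarrow>
      closedin (subtopology (realization L) (topspace (realization K))) C" for C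
  proof
    assume C: "closedin (realization K) C"
    have "closed (C \<inter> closed_cell \<sigma>)" if "\<sigma> \<in> L" for \<sigma>
      using closedin_realization_Int_cell[OF K abstract_complexD(1)[OF L that] C] .
    then have "closedin (realization L) C"
      using closedin_subset[OF C] top by (auto simp: closedin_realization[OF L])
    then show "closedin (subtopology (realization L) (topspace (realization K))) C"
      using closedin_subset[OF C] by (metis closedin_subset_topspace)
  next
    assume "closedin (subtopology (realization L) (topspace (realization K))) C"
    then obtain D where D: "closedin (realization L) D" "C = D \<inter> topspace (realization K)"
      by (auto simp: closedin_subtopology)
    have "C \<inter> closed_cell \<sigma> = D \<inter> closed_cell \<sigma>" if "\<sigma> \<in> K" for \<sigma>
      using D that by (auto simp: topspace_realization)
    then show "closedin (realization K) C"
      using D KL by (auto simp: closedin_realization[OF K] closedin_realization[OF L])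
  qed
  then show "realization K = subtopology (realization L) (topspace (realization K))"
    using top topology_finer_closedin[of "realization K"
        "subtopology (realization L) (topspace (realization K))"]
      topology_finer_closedin[of "subtopology (realization L) (topspace (realization K))"
        "realization K"]
    unfolding topology_eq by (simp add: inf_absorb2) blast
qed

section \<open>Maps and homotopies between realizations\<close>

lemma continuous_map_coordinate_on_cell:
  assumes "abstract_complex K" "\<sigma> \<in> K" "continuous_map (realization K) (realization L) f"
  shows "continuous_map (top_of_set (closed_cell \<sigma>)) euclideanreal (\<lambda>x. f x v)"
  using continuous_map_compose[OF continuous_map_compose[OF
        continuous_map_cell_inclusion[OF assms(1,2)] assms(3)] continuous_map_coordinate]
  by (simp add: o_def)

lemma unit_interval_locally_compact:
  "locally_compact_space (top_of_set {0..1 :: real})" "Hausdorff_space (top_of_set {0..1 :: real})"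
proof -
  show H: "Hausdorff_space (top_of_set {0..1 :: real})"
    by (simp add: Hausdorff_space_subtopology)
  show "locally_compact_space (top_of_set {0..1 :: real})"
    by (rule compact_imp_locally_compact_space) (simp add: compact_space_subtopology)
qed

text \<open>The homotopy moves along straight line segments, which stay in a common closed cell.\<close>
lemma homotopic_contiguous:
  assumes K: "abstract_complex K" and L: "abstract_complex L"
    and f: "continuous_map (realization K) (realization L) f"
    and g: "continuous_map (realization K) (realization L) g"
    and common: "\<And>x. x \<in> topspace (realization K) \<Longrightarrow>
      \<exists>\<tau>\<in>L. f x \<in> closed_cell \<tau> \<and> g x \<in> closed_cell \<tau>"
  shows "homotopic_with (\<lambda>_. True) (realization K) (realization L) f g"
proof -
  define h where "h = (\<lambda>(t :: real, x). \<lambda>v. (1 - t) * f x v + t * g x v)"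
  have "continuous_map (prod_topology (top_of_set {0..1}) (realization K)) (realization L) h"
  proof (rule continuous_map_from_realization_prod[OF unit_interval_locally_compact])
    fix \<sigma> assume \<sigma>: "\<sigma> \<in> K"
    let ?I = "top_of_set {0..1 :: real}" and ?C = "top_of_set (closed_cell \<sigma>)"
    let ?S = "(\<Union>x\<in>f ` closed_cell \<sigma>. supp x) \<union> (\<Union>x\<in>g ` closed_cell \<sigma>. supp x)"
    show "continuous_map (prod_topology ?I ?C) (realization L) h"
    proof (rule continuous_map_into_realization[OF L, of ?S])
      show "finite ?S"
        using compactin_realization_finite_supp[OF L] image_compactin[OF compactin_cell[OF K \<sigma>]] f g
        by blast
    next
      fix a assume "a \<in> topspace (prod_topology ?I ?C)"
      then obtain t x where a: "a = (t, x)" "0 \<le> t" "t \<le> 1" "x \<in> closed_cell \<sigma>"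
        by auto
      then obtain \<tau> where \<tau>: "\<tau> \<in> L" "f x \<in> closed_cell \<tau>" "g x \<in> closed_cell \<tau>"
        using common \<sigma> by (auto simp: topspace_realization)
      have "h a \<in> closed_cell \<tau>"
        using \<tau> a by (auto simp: closed_cell_def h_def sum.distrib simp flip: sum_distrib_left)
      with \<tau> show "h a \<in> topspace (realization L)"
        by (auto simp: topspace_realization)
      show "supp (h a) \<subseteq> ?S"
        using a by (auto simp: supp_def h_def)
    next
      fix v
      have fst: "continuous_map (prod_topology ?I ?C) euclideanreal fst"
        using continuous_map_fst[of ?I ?C] continuous_map_into_fulltopology by blast
      have fv: "continuous_map (prod_topology ?I ?C) euclideanreal (\<lambda>a. f (snd a) v)"
        "continuous_map (prod_topology ?I ?C) euclideanreal (\<lambda>a. g (snd a) v)"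
        using continuous_map_compose[OF continuous_map_snd[of ?I ?C]
            continuous_map_coordinate_on_cell[OF K \<sigma>]] f g by (auto simp: o_def)
      have "continuous_map (prod_topology ?I ?C) euclideanreal
          (\<lambda>a. (1 - fst a) * f (snd a) v + fst a * g (snd a) v)"
        by (intro continuous_map_add continuous_map_real_mult continuous_map_diff fst fv) simp
      then show "continuous_map (prod_topology ?I ?C) euclideanreal (\<lambda>a. h a v)"
        by (simp add: h_def case_prod_beta)
    qed
  qed
  then show ?thesis
    unfolding homotopic_with_def by (intro exI[of _ h]) (auto simp: h_def)
qed

text \<open>The map that is affine on every closed cell and sends the vertex \<open>v\<close> to the point \<open>p v\<close>. Summing over
the support, instead of over a given simplex, gives one formula for all complexes, so that the
map does not depend on the complex.\<close>
definition lin :: "('v \<Rightarrow> 'w \<Rightarrow> real) \<Rightarrow> ('v \<Rightarrow> real) \<Rightarrow> 'w \<Rightarrow> real" where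
  "lin p x = (\<lambda>w. \<Sum>v\<in>supp x. x v * p v w)"

lemma lin_eq:
  assumes "finite S" "supp x \<subseteq> S"
  shows "lin p x w = (\<Sum>v\<in>S. x v * p v w)"
  unfolding lin_def by (rule sum.mono_neutral_left) (use assms in \<open>auto simp: supp_def\<close>)

lemma lin_in_closed_cell:
  assumes \<sigma>: "finite \<sigma>" "x \<in> closed_cell \<sigma>" and p: "\<And>v. v \<in> supp x \<Longrightarrow> p v \<in> closed_cell \<tau>"
  shows "lin p x \<in> closed_cell \<tau>"
proof -
  have x: "\<And>v. 0 \<le> x v" "sum x (supp x) = 1"
    using \<sigma> closed_cell_iff by blast+
  have "(\<Sum>w\<in>\<tau>. \<Sum>v\<in>supp x. x v * p v w) = (\<Sum>v\<in>supp x. x v * (\<Sum>w\<in>\<tau>. p v w))"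
    by (subst sum.swap) (simp add: sum_distrib_left)
  also have "\<dots> = (\<Sum>v\<in>supp x. x v)"
    by (intro sum.cong) (use p in \<open>auto simp: closed_cell_def\<close>)
  finally have "sum (lin p x) \<tau> = 1"
    using x by (simp add: lin_def)
  moreover have "0 \<le> lin p x w" for w
    unfolding lin_def by (intro sum_nonneg) (use p x in \<open>auto simp: closed_cell_def\<close>)
  moreover have "lin p x w = 0" if "w \<notin> \<tau>" for w
    unfolding lin_def by (intro sum.neutral) (use p that in \<open>auto simp: closed_cell_def\<close>)
  ultimately show ?thesis by (auto simp: closed_cell_def)
qed

lemma continuous_map_lin:
  assumes K: "abstract_complex K" and L: "abstract_complex L"
    and p: "\<And>\<sigma>. \<sigma> \<in> K \<Longrightarrow> \<exists>\<tau>\<in>L. \<forall>v\<in>\<sigma>. p v \<in> closed_cell \<tau>"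
  shows "continuous_map (realization K) (realization L) (lin p)"
proof (rule continuous_map_from_realization)
  fix \<sigma> assume \<sigma>: "\<sigma> \<in> K"
  have fin: "finite \<sigma>" using K \<sigma> abstract_complexD by blast
  obtain \<tau> where \<tau>: "\<tau> \<in> L" "\<forall>v\<in>\<sigma>. p v \<in> closed_cell \<tau>" using p[OF \<sigma>] by blast
  have fin': "finite \<tau>" using L \<tau> abstract_complexD by blast
  have in_\<tau>: "lin p x \<in> closed_cell \<tau>" if "x \<in> closed_cell \<sigma>" for x
    using lin_in_closed_cell[OF fin that] \<tau> that closed_cell_iff[OF fin, of x] by blast
  show "continuous_map (top_of_set (closed_cell \<sigma>)) (realization L) (lin p)"
  proof (rule continuous_map_into_realization[OF L fin'])
    fix x assume "x \<in> topspace (top_of_set (closed_cell \<sigma>))"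
    then have "lin p x \<in> closed_cell \<tau>" using in_\<tau> by simp
    then show "lin p x \<in> topspace (realization L)" "supp (lin p x) \<subseteq> \<tau>"
      using \<tau>(1) closed_cell_iff[OF fin'] by (auto simp: topspace_realization)
  next
    fix w
    have "continuous_map (top_of_set (closed_cell \<sigma>)) euclideanreal (\<lambda>x. \<Sum>v\<in>\<sigma>. x v * p v w)"
      using continuous_map_coordinate_on_cell[OF K \<sigma> continuous_map_id]
      by (intro continuous_map_sum continuous_map_real_mult) (auto simp: fin)
    then show "continuous_map (top_of_set (closed_cell \<sigma>)) euclideanreal (\<lambda>x. lin p x w)"
      by (rule continuous_map_eq) (use lin_eq[OF fin, of _ p w] closed_cell_iff[OF fin] in simp)
  qed
qed

definition vertex :: "'v \<Rightarrow> 'v \<Rightarrow> real" where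
  "vertex v = (\<lambda>w. if w = v then 1 else 0)"

lemma vertex_in_closed_cell: "finite \<sigma> \<Longrightarrow> v \<in> \<sigma> \<Longrightarrow> vertex v \<in> closed_cell \<sigma>"
  by (auto simp: closed_cell_def vertex_def)

definition simplicial :: "('v \<Rightarrow> 'w) \<Rightarrow> ('v \<Rightarrow> real) \<Rightarrow> 'w \<Rightarrow> real" where
  "simplicial \<phi> = lin (\<lambda>v. vertex (\<phi> v))"

lemma simplicial_in_closed_cell:
  assumes "finite \<sigma>" "x \<in> closed_cell \<sigma>" "finite \<tau>" "\<phi> ` supp x \<subseteq> \<tau>"
  shows "simplicial \<phi> x \<in> closed_cell \<tau>"
  unfolding simplicial_def
  by (rule lin_in_closed_cell[OF assms(1,2)]) (use assms in \<open>auto intro!: vertex_in_closed_cell\<close>)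

lemma supp_simplicial: "supp (simplicial \<phi> x) \<subseteq> \<phi> ` supp x"
proof
  fix w assume "w \<in> supp (simplicial \<phi> x)"
  then have "(\<Sum>v\<in>supp x. x v * vertex (\<phi> v) w) \<noteq> 0"
    by (simp add: supp_def simplicial_def lin_def)
  then obtain v where "v \<in> supp x" "x v * vertex (\<phi> v) w \<noteq> 0"
    by (metis (no_types, lifting) sum.not_neutral_contains_not_neutral)
  then show "w \<in> \<phi> ` supp x"
    by (auto simp: vertex_def split: if_splits)
qed

lemma continuous_map_simplicial:
  assumes K: "abstract_complex K" and L: "abstract_complex L"
    and \<phi>: "\<And>\<sigma>. \<sigma> \<in> K \<Longrightarrow> \<phi> ` \<sigma> \<in> L"
  shows "continuous_map (realization K) (realization L) (simplicial \<phi>)"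
  unfolding simplicial_def
proof (rule continuous_map_lin[OF K L])
  fix \<sigma> assume "\<sigma> \<in> K"
  then have \<sigma>: "\<phi> ` \<sigma> \<in> L" by (rule \<phi>)
  show "\<exists>\<tau>\<in>L. \<forall>v\<in>\<sigma>. vertex (\<phi> v) \<in> closed_cell \<tau>"
    by (rule bexI[OF _ \<sigma>]) (auto intro!: vertex_in_closed_cell abstract_complexD(1)[OF L \<sigma>])
qed

section \<open>Order complexes\<close>

text \<open>The relation \<open>le\<close> is arbitrary so that the same notion serves for flags ordered by inclusion and for the
ordered pairs of sets below; since \<open>a = b\<close> is allowed, comparability includes \<open>le a a\<close>.\<close>
definition order_complex :: "('p \<Rightarrow> 'p \<Rightarrow> bool) \<Rightarrow> 'p set \<Rightarrow> 'p set set" where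
  "order_complex le P = {c. c \<subseteq> P \<and> finite c \<and> c \<noteq> {} \<and> (\<forall>a\<in>c. \<forall>b\<in>c. le a b \<or> le b a)}"

lemma abstract_complex_order_complex: "abstract_complex (order_complex le P)"
  unfolding abstract_complex_def
proof (intro ballI conjI allI impI)
  fix c assume c: "c \<in> order_complex le P"
  then show "finite c" "c \<noteq> {}" by (simp_all add: order_complex_def)
  fix d assume "d \<subseteq> c \<and> d \<noteq> {}"
  with c show "d \<in> order_complex le P"
    by (simp add: order_complex_def subset_iff finite_subset[of d c])
qed

lemma Sd_eq_order_complex: "Sd P = order_complex (\<subseteq>) P"
  unfolding Sd_def order_complex_def subset_chain_def 
  by (rule Collect_cong) (intro iffI conjI; elim conjE; assumption)

text \<open>Arrange the support of \<open>x\<close> in increasing order and cut the unit interval into consecutive pieces of length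
\<open>x p\<close>; the piece of \<open>p\<close> starts at \<open>b\<close>. The part of that piece in the interval from \<open>0\<close> to \<open>1 - t\<close> is the weight
of the bottom vertex \<open>(p, False)\<close>, and the rest is the weight of the top vertex \<open>(p, True)\<close>. These are the
barycentric coordinates in the standard triangulation of the prism over a simplex.\<close>
definition prism :: "real \<Rightarrow> ('p::order \<Rightarrow> real) \<Rightarrow> 'p \<times> bool \<Rightarrow> real" where
  "prism t x = (\<lambda>(p, i).
     let b = (\<Sum>q\<in>{q \<in> supp x. q < p}. x q); l = min (b + x p) (1 - t) - min b (1 - t)
     in if i then x p - l else l)"

lemma supp_prism: "supp (prism t x) \<subseteq> supp x \<times> UNIV"
  by (auto simp: supp_def prism_def split: if_splits)

lemma prism_in_closed_cell:
  fixes x :: "'p::order \<Rightarrow> real"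
  assumes "finite \<sigma>" "x \<in> closed_cell \<sigma>"
  shows "prism t x \<in> closed_cell (\<sigma> \<times> UNIV)"
proof -
  have x: "\<And>v. 0 \<le> x v" "\<And>v. v \<notin> \<sigma> \<Longrightarrow> x v = 0" "sum x \<sigma> = 1"
    using assms(2) by (auto simp: closed_cell_def)
  have "sum (prism t x) (\<sigma> \<times> UNIV) = (\<Sum>p\<in>\<sigma>. \<Sum>i\<in>UNIV. prism t x (p, i))"
    by (simp add: sum.cartesian_product)
  also have "\<dots> = sum x \<sigma>"
    by (intro sum.cong) (auto simp: prism_def UNIV_bool Let_def)
  finally have "sum (prism t x) (\<sigma> \<times> UNIV) = 1" using x by simp
  moreover have "0 \<le> prism t x (p, i)" for p i
    using x(1)[of p] by (auto simp: prism_def Let_def)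
  moreover have "prism t x (p, i) = 0" if "p \<notin> \<sigma>" for p i
    using x(2)[OF that] by (auto simp: prism_def)
  ultimately show ?thesis
    by (auto simp: closed_cell_def)
qed

text \<open>Pieces of the interval that reach below the cut \<open>1 - t\<close> come no later than those that reach above it. This
makes the supporting vertices of a point of the prism a chain.\<close>
lemma prism_supp_ordered:
  fixes x :: "'p::order \<Rightarrow> real"
  assumes x: "\<And>v. 0 \<le> x v" "finite (supp x)"
    and tot: "\<And>p q. p \<in> supp x \<Longrightarrow> q \<in> supp x \<Longrightarrow> p \<le> q \<or> q \<le> p"
    and p: "(p, False) \<in> supp (prism t x)" and q: "(q, True) \<in> supp (prism t x)"
  shows "p \<le> q"
proof (rule ccontr)
  assume "\<not> p \<le> q"
  define B where "B r = (\<Sum>q\<in>{q \<in> supp x. q < r}. x q)" for r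
  have p': "min (B p + x p) (1 - t) - min (B p) (1 - t) \<noteq> 0"
    using p by (simp add: supp_def prism_def B_def Let_def)
  have q': "x q \<noteq> min (B q + x q) (1 - t) - min (B q) (1 - t)"
    using q by (simp add: supp_def prism_def B_def Let_def)
  have "p \<in> supp x" "q \<in> supp x"
    using p' q' by (auto simp: supp_def)
  then have "q < p" using tot[of p q] \<open>\<not> p \<le> q\<close> by auto
  then have "insert q {r \<in> supp x. r < q} \<subseteq> {r \<in> supp x. r < p}"
    using \<open>q \<in> supp x\<close> by auto
  then have "sum x (insert q {r \<in> supp x. r < q}) \<le> B p"
    unfolding B_def by (intro sum_mono2) (use x in auto)
  then have "x q + B q \<le> B p"
    using x(2) by (simp add: B_def)
  then show False
    using p' q' x(1)[of p] x(1)[of q] by (auto simp: min_def split: if_splits)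
qed

text \<open>The two maps need not be contiguous: on a chain, the largest value of \<open>f\<close> and the smallest value of \<open>g\<close> may be
incomparable. The homotopy therefore goes through the prism, sending bottom vertices by \<open>f\<close> and top
vertices by \<open>g\<close>: in a simplex of the triangulated prism, bottom vertices precede top vertices, so
that its image is a chain.\<close>
lemma homotopic_simplicial_mono:
  fixes f g :: "'p::order \<Rightarrow> 'q"
  assumes f: "f ` P \<subseteq> Q" and g: "g ` P \<subseteq> Q"
    and mono_f: "\<And>a b. a \<in> P \<Longrightarrow> b \<in> P \<Longrightarrow> a \<le> b \<Longrightarrow> le (f a) (f b)"
    and mono_g: "\<And>a b. a \<in> P \<Longrightarrow> b \<in> P \<Longrightarrow> a \<le> b \<Longrightarrow> le (g a) (g b)"
    and le: "\<And>a. a \<in> P \<Longrightarrow> le (f a) (g a)" and trans: "transp le"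
  shows "homotopic_with (\<lambda>_. True) (realization (order_complex (\<le>) P)) (realization (order_complex le Q))
    (simplicial f) (simplicial g)"
proof -
  let ?K = "order_complex (\<le>) P" and ?L = "order_complex le Q"
  note K = abstract_complex_order_complex[of "(\<le>)" P] and L = abstract_complex_order_complex[of le Q]
  define e where "e = (\<lambda>(p, i). if i then g p else f p)"
  define h where "h = (\<lambda>(t, x). simplicial e (prism t x))"
  have "continuous_map (prod_topology (top_of_set {0..1}) (realization ?K)) (realization ?L) h"
  proof (rule continuous_map_from_realization_prod[OF unit_interval_locally_compact])
    fix \<sigma> assume \<sigma>: "\<sigma> \<in> ?K"
    have fin: "finite \<sigma>" using K \<sigma> abstract_complexD by blast
    let ?I = "top_of_set {0..1 :: real}" and ?C = "top_of_set (closed_cell \<sigma>)"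
    show "continuous_map (prod_topology ?I ?C) (realization ?L) h"
    proof (rule continuous_map_into_realization[OF L, of "e ` (\<sigma> \<times> UNIV)"])
      show "finite (e ` (\<sigma> \<times> UNIV))" using fin by simp
    next
      fix a assume "a \<in> topspace (prod_topology ?I ?C)"
      then obtain t x where a: "a = (t, x)" "x \<in> closed_cell \<sigma>"
        by auto
      have x: "\<And>v. 0 \<le> x v" "supp x \<subseteq> \<sigma>"
        using a closed_cell_iff[OF fin] by blast+
      have y: "prism t x \<in> closed_cell (\<sigma> \<times> UNIV)"
        by (rule prism_in_closed_cell[OF fin a(2)])
      note y_supp = supp_prism[of t x]
      have y_fin: "finite (supp (prism t x))"
        using finite_subset[OF y_supp] finite_subset[OF x(2) fin] by simp
      have y_ne: "supp (prism t x) \<noteq> {}"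
        using y fin closed_cell_iff[of "\<sigma> \<times> UNIV" "prism t x"] by auto
      have tot: "p \<le> q \<or> q \<le> p" if "p \<in> supp x" "q \<in> supp x" for p q
        using that x(2) \<sigma> unfolding order_complex_def by blast
      have ord: "p \<le> q" if "(p, False) \<in> supp (prism t x)" "(q, True) \<in> supp (prism t x)" for p q
        by (rule prism_supp_ordered[OF x(1) finite_subset[OF x(2) fin] tot that])
      have inP: "supp x \<subseteq> P" using x \<sigma> by (auto simp: order_complex_def)
      have fg: "le (f p) (g q)" if "p \<in> P" "q \<in> P" "p \<le> q" for p q
        using that mono_f le trans by (meson transpD)
      have "e ` supp (prism t x) \<in> ?L"
        unfolding order_complex_def
      proof (intro CollectI conjI)
        show "e ` supp (prism t x) \<subseteq> Q"
        proof (rule image_subsetI)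
          fix r assume "r \<in> supp (prism t x)"
          then have "r \<in> supp x \<times> UNIV" using y_supp by (rule subsetD[rotated])
          then have "fst r \<in> P" using inP by (cases r) auto
          with f g show "e r \<in> Q" by (cases r) (simp add: e_def image_subset_iff)
        qed
        have "le (e r) (e s) \<or> le (e s) (e r)"
          if r: "r \<in> supp (prism t x)" and s: "s \<in> supp (prism t x)" for r s
        proof -
          obtain p i q j where rs: "r = (p, i)" "s = (q, j)" by fastforce
          have pq: "p \<in> supp x" "q \<in> supp x" "p \<in> P" "q \<in> P"
            using r s rs y_supp inP by auto
          show ?thesis
            using r s rs pq tot[OF pq(1,2)] ord mono_f mono_g fg
            by (cases i; cases j) (auto simp: e_def)
        qed
        then show "\<forall>a\<in>e ` supp (prism t x). \<forall>b\<in>e ` supp (prism t x). le a b \<or> le b a"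
          by blast
      qed (use y_fin y_ne in auto)
      moreover have "h a \<in> closed_cell (e ` supp (prism t x))"
        unfolding h_def a prod.case
        by (rule simplicial_in_closed_cell[OF _ y]) (use fin y_fin in auto)
      ultimately show "h a \<in> topspace (realization ?L)"
        by (auto simp: topspace_realization)
      show "supp (h a) \<subseteq> e ` (\<sigma> \<times> UNIV)"
      proof -
        have "supp (prism t x) \<subseteq> \<sigma> \<times> UNIV" using y_supp x(2) by blast
        then have "e ` supp (prism t x) \<subseteq> e ` (\<sigma> \<times> UNIV)" by (rule image_mono)
        then show ?thesis
          unfolding h_def a prod.case by (rule order_trans[OF supp_simplicial])
      qed
    next
      fix w
      have fst: "continuous_map (prod_topology ?I ?C) euclideanreal fst"
        using continuous_map_fst[of ?I ?C] continuous_map_into_fulltopology by blast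
      have snd: "continuous_map (prod_topology ?I ?C) euclideanreal (\<lambda>a. snd a v)" for v
        using continuous_map_compose[OF continuous_map_snd[of ?I ?C]
            continuous_map_coordinate_on_cell[OF K \<sigma> continuous_map_id]] by (simp add: o_def)
      let ?B = "\<lambda>a p. \<Sum>q\<in>{q \<in> \<sigma>. q < p}. snd a q"
      let ?l = "\<lambda>a p. min (?B a p + snd a p) (1 - fst a) - min (?B a p) (1 - fst a)"
      have l: "continuous_map (prod_topology ?I ?C) euclideanreal (\<lambda>a. ?l a p)" for p
        by (intro continuous_map_diff continuous_map_real_min continuous_map_add continuous_map_sum
            fst snd) (use fin in auto)
      have "continuous_map (prod_topology ?I ?C) euclideanreal
          (\<lambda>a. \<Sum>(p, i)\<in>\<sigma> \<times> UNIV. (if i then snd a p - ?l a p else ?l a p) * vertex (e (p, i)) w)"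
      proof (intro continuous_map_sum)
        fix r :: "'p \<times> bool"
        obtain p i where r: "r = (p, i)" by fastforce
        have const: "continuous_map (prod_topology ?I ?C) euclideanreal (\<lambda>_. vertex (e (p, i)) w)"
          by simp
        have "continuous_map (prod_topology ?I ?C) euclideanreal
            (\<lambda>a. if i then snd a p - ?l a p else ?l a p)"
          by (cases i; simp only: if_True if_False; intro continuous_map_diff[OF snd l] l)
        from continuous_map_real_mult[OF this const]
        show "continuous_map (prod_topology ?I ?C) euclideanreal
          (\<lambda>a. case r of (p, i) \<Rightarrow> (if i then snd a p - ?l a p else ?l a p) * vertex (e (p, i)) w)"
          by (simp only: r prod.case)
      qed (use fin in simp)
      then show "continuous_map (prod_topology ?I ?C) euclideanreal (\<lambda>a. h a w)"
      proof (rule continuous_map_eq)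
        fix a assume "a \<in> topspace (prod_topology ?I ?C)"
        then obtain t x where a: "a = (t, x)" "x \<in> closed_cell \<sigma>"
          by auto
        have B: "?B (t, x) p = (\<Sum>q\<in>{q \<in> supp x. q < p}. x q)" for p
          unfolding snd_conv by (rule sum.mono_neutral_right)
            (use fin a closed_cell_iff[OF fin, of x] in \<open>auto simp: supp_def\<close>)
        have sub: "supp (prism t x) \<subseteq> \<sigma> \<times> UNIV"
          using supp_prism[of t x] a(2) closed_cell_iff[OF fin, of x] by blast
        have "h a w = (\<Sum>r\<in>\<sigma> \<times> UNIV. prism t x r * vertex (e r) w)"
          unfolding h_def a prod.case simplicial_def by (rule lin_eq[OF _ sub]) (simp add: fin)
        also have "\<dots> = (\<Sum>(p, i)\<in>\<sigma> \<times> UNIV.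
            (if i then snd a p - ?l a p else ?l a p) * vertex (e (p, i)) w)"
        proof (rule sum.cong[OF refl])
          fix r :: "'p \<times> bool"
          obtain p i where r: "r = (p, i)" by fastforce
          show "prism t x r * vertex (e r) w = (case r of (p, i) \<Rightarrow>
              (if i then snd a p - ?l a p else ?l a p) * vertex (e (p, i)) w)"
            unfolding r a prod.case B unfolding prism_def prod.case Let_def by simp
        qed
        finally show "(\<Sum>(p, i)\<in>\<sigma> \<times> UNIV.
            (if i then snd a p - ?l a p else ?l a p) * vertex (e (p, i)) w) = h a w" ..
      qed
    qed
  qed
  moreover have "h (0, x) = simplicial f x \<and> h (1, x) = simplicial g x"
    if x: "x \<in> topspace (realization ?K)" for x
  proof -
    have x: "\<And>v. 0 \<le> x v" "finite (supp x)" "sum x (supp x) = 1"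
      using x K by (auto simp: in_realization_iff abstract_complexD)
    define B where "B p = (\<Sum>q\<in>{q \<in> supp x. q < p}. x q)" for p
    have B: "0 \<le> B p" for p unfolding B_def by (intro sum_nonneg) (use x in auto)
    have B1: "B p + x p \<le> 1" for p
    proof (cases "p \<in> supp x")
      case True
      then have "x p + B p = sum x (insert p {q \<in> supp x. q < p})"
        using x by (simp add: B_def)
      also have "\<dots> \<le> sum x (supp x)"
        by (intro sum_mono2) (use x True in auto)
      finally show ?thesis using x by simp
    next
      case False
      have "B p \<le> sum x (supp x)" unfolding B_def by (intro sum_mono2) (use x in auto)
      with False x show ?thesis by (simp add: supp_def)
    qed
    have y: "prism t x (p, i) = (let l = min (B p + x p) (1 - t) - min (B p) (1 - t)
      in if i then x p - l else l)" for t p i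
      by (simp add: prism_def B_def Let_def)
    have y0: "prism 0 x (p, i) = (if i then 0 else x p)" for p i
      using B1[of p] B[of p] x(1)[of p] by (auto simp: y Let_def min_def)
    have y1: "prism 1 x (p, i) = (if i then x p else 0)" for p i
      using B1[of p] B[of p] x(1)[of p] by (auto simp: y Let_def min_def)
    have lin: "h (t, x) w = (\<Sum>p\<in>supp x. \<Sum>i\<in>UNIV. prism t x (p, i) * vertex (e (p, i)) w)" for t w
      unfolding h_def prod.case simplicial_def
      by (subst lin_eq[OF _ supp_prism]) (simp_all add: x sum.cartesian_product case_prod_beta)
    show ?thesis
      by (auto simp: lin y0 y1 UNIV_bool e_def simplicial_def lin_def fun_eq_iff)
  qed
  ultimately show ?thesis
    by (subst homotopic_with) (auto intro!: exI[of _ h])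
qed

section \<open>Barycentric subdivision\<close>

definition bary :: "'v set \<Rightarrow> 'v \<Rightarrow> real" where
  "bary \<sigma> = (\<lambda>v. if v \<in> \<sigma> then 1 / card \<sigma> else 0)"

lemma bary_in_closed_cell:
  assumes "finite \<tau>" "\<sigma> \<subseteq> \<tau>" "\<sigma> \<noteq> {}"
  shows "bary \<sigma> \<in> closed_cell \<tau>"
proof -
  have "finite \<sigma>" using assms finite_subset by blast
  then have "sum (bary \<sigma>) \<sigma> = 1"
    using assms(3) by (simp add: bary_def)
  moreover have "sum (bary \<sigma>) \<sigma> = sum (bary \<sigma>) \<tau>"
    by (rule sum.mono_neutral_left) (use assms in \<open>auto simp: bary_def\<close>)
  ultimately show ?thesis
    using assms by (auto simp: closed_cell_def bary_def)
qed

text \<open>The points of a realized subdivision without the normalization that the weights add up to \<open>1\<close>. Dropping it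
allows inductions that peel off one member of the flag at a time.\<close>
definition flag_weights :: "('v set \<Rightarrow> real) \<Rightarrow> bool" where
  "flag_weights y \<longleftrightarrow> (\<forall>\<sigma>. 0 \<le> y \<sigma>) \<and> finite (supp y) \<and> (\<forall>\<sigma>\<in>supp y. finite \<sigma> \<and> \<sigma> \<noteq> {}) \<and>
     (\<forall>\<sigma>\<in>supp y. \<forall>\<tau>\<in>supp y. \<sigma> \<subseteq> \<tau> \<or> \<tau> \<subseteq> \<sigma>)"

lemma in_realization_Sd_iff:
  assumes "abstract_complex K"
  shows "y \<in> topspace (realization (Sd K)) \<longleftrightarrow>
    flag_weights y \<and> supp y \<subseteq> K \<and> sum y (supp y) = 1"
proof -
  have "supp y \<noteq> {}" if "sum y (supp y) = 1" using that by auto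
  moreover have "finite \<sigma> \<and> \<sigma> \<noteq> {}" if "supp y \<subseteq> K" "\<sigma> \<in> supp y" for \<sigma>
    using abstract_complexD(1,2)[OF assms] that by blast
  ultimately show ?thesis
    unfolding Sd_eq_order_complex in_realization_iff[OF abstract_complex_order_complex]
    unfolding order_complex_def flag_weights_def by (intro iffI; clarsimp)
qed

lemma supp_lin_bary:
  assumes "flag_weights y"
  shows "supp (lin bary y) = \<Union>(supp y)"
proof -
  have "lin bary y v \<noteq> 0 \<longleftrightarrow> (\<exists>\<sigma>\<in>supp y. y \<sigma> * bary \<sigma> v \<noteq> 0)" for v
    unfolding lin_def
    using assms by (subst sum_nonneg_eq_0_iff) (auto simp: flag_weights_def bary_def)
  also have "(\<exists>\<sigma>\<in>supp y. y \<sigma> * bary \<sigma> v \<noteq> 0) \<longleftrightarrow> (\<exists>\<sigma>\<in>supp y. v \<in> \<sigma>)" for v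
    by (rule bex_cong) (use assms in \<open>auto simp: flag_weights_def bary_def supp_def\<close>)
  finally have "lin bary y v \<noteq> 0 \<longleftrightarrow> v \<in> \<Union>(supp y)" for v by simp
  then show ?thesis
    unfolding supp_def[of "lin bary y"] by (intro set_eqI) (simp only: mem_Collect_eq)
qed

lemma lin_fun_upd:
  assumes "finite (supp y)" "y s = 0"
  shows "lin p (y(s := a)) w = a * p s w + lin p y w"
proof -
  have "lin p (y(s := a)) w = (\<Sum>v\<in>insert s (supp y). (y(s := a)) v * p v w)"
    by (rule lin_eq) (use assms in \<open>auto simp: supp_def\<close>)
  also have "\<dots> = a * p s w + (\<Sum>v\<in>supp y. (y(s := a)) v * p v w)"
    using assms by (simp add: supp_def)
  also have "(\<Sum>v\<in>supp y. (y(s := a)) v * p v w) = lin p y w"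
    unfolding lin_def by (rule sum.cong) (use assms in \<open>auto simp: supp_def\<close>)
  finally show ?thesis .
qed

lemma flag_weights_mono:
  assumes y: "flag_weights y" and z: "\<And>\<sigma>. 0 \<le> z \<sigma>" "supp z \<subseteq> supp y"
  shows "flag_weights z"
proof -
  have "finite (supp z)"
    using y finite_subset[OF z(2)] by (simp add: flag_weights_def)
  then show ?thesis
    using y z(1) subsetD[OF z(2)] by (simp add: flag_weights_def)
qed

lemma flag_weights_fun_upd:
  assumes y: "flag_weights y" and s: "finite s" "s \<noteq> {}" "\<And>\<sigma>. \<sigma> \<in> supp y \<Longrightarrow> \<sigma> \<subseteq> s" and a: "0 \<le> a"
  shows "flag_weights (y(s := a))"
proof -
  have sub: "\<sigma> = s \<or> \<sigma> \<in> supp y" if "\<sigma> \<in> supp (y(s := a))" for \<sigma>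
    using that by (auto simp: supp_def split: if_splits)
  then have "finite (supp (y(s := a)))"
    using y finite_subset[of "supp (y(s := a))" "insert s (supp y)"] by (auto simp: flag_weights_def)
  moreover have "0 \<le> (y(s := a)) \<sigma>" for \<sigma>
    using y a by (simp add: flag_weights_def)
  moreover have "finite \<sigma> \<and> \<sigma> \<noteq> {}" if "\<sigma> \<in> supp (y(s := a))" for \<sigma>
    using sub[OF that] s(1,2) y by (auto simp: flag_weights_def)
  moreover have "\<sigma> \<subseteq> \<tau> \<or> \<tau> \<subseteq> \<sigma>" if "\<sigma> \<in> supp (y(s := a))" "\<tau> \<in> supp (y(s := a))" for \<sigma> \<tau>
    using sub[OF that(1)] sub[OF that(2)] s(3) y unfolding flag_weights_def by blast
  ultimately show ?thesis
    unfolding flag_weights_def by simp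
qed

text \<open>Subtracting the smallest positive coordinate on the whole support removes a multiple of the barycentre of
the support and leaves a point with strictly smaller support, to which induction applies.\<close>
lemma ex_flag_weights:
  assumes "\<And>v. 0 \<le> x v" "finite (supp x)"
  shows "\<exists>y. flag_weights y \<and> lin bary y = x"
  using assms
proof (induction "card (supp x)" arbitrary: x rule: less_induct)
  case less
  show ?case
  proof (cases "supp x = {}")
    case True
    then have "lin bary (\<lambda>_. 0) = x" "flag_weights (\<lambda>_. 0 :: real)"
      by (auto simp: lin_def supp_def flag_weights_def)
    then show ?thesis by blast
  next
    case False
    define m where "m = Min (x ` supp x)"
    define x' where "x' v = (if v \<in> supp x then x v - m else 0)" for v
    have m_le: "m \<le> x v" if "v \<in> supp x" for v
      unfolding m_def using that less.prems by simp
    have "m \<in> x ` supp x" unfolding m_def using less.prems False by simp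
    then obtain v0 where v0: "v0 \<in> supp x" "x v0 = m" by auto
    then have "supp x' \<subset> supp x" by (auto simp: supp_def x'_def)
    then have *: "card (supp x') < card (supp x)" "finite (supp x')"
      using less.prems by (auto intro: psubset_card_mono finite_subset)
    moreover have "0 \<le> x' v" for v using m_le by (simp add: x'_def)
    ultimately obtain y where y: "flag_weights y" "lin bary y = x'"
      using less.hyps by blast
    then have U: "\<Union>(supp y) = supp x'" using supp_lin_bary by blast
    then have y0: "y (supp x) = 0"
      using \<open>supp x' \<subset> supp x\<close> by (auto simp: supp_def[of y])
    let ?y = "y(supp x := m * card (supp x))"
    have "m \<ge> 0" using v0 less.prems(1)[of v0] by simp
    have "\<sigma> \<subseteq> supp x" if "\<sigma> \<in> supp y" for \<sigma>
      using that U \<open>supp x' \<subset> supp x\<close> by blast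
    then have "flag_weights ?y"
      using \<open>m \<ge> 0\<close> False less.prems(2) by (intro flag_weights_fun_upd[OF y(1)]) auto
    moreover have "lin bary ?y w = x w" for w
    proof -
      have "lin bary ?y w = m * card (supp x) * bary (supp x) w + x' w"
        using y y0 lin_fun_upd[of y "supp x" bary "m * card (supp x)" w]
        by (simp add: flag_weights_def)
      also have "\<dots> = x w"
      proof (cases "w \<in> supp x")
        case True
        then show ?thesis using less.prems(2) by (auto simp: bary_def x'_def)
      next
        case w: False
        then show ?thesis by (simp add: bary_def x'_def supp_def)
      qed
      finally show ?thesis .
    qed
    ultimately show ?thesis by blast
  qed
qed

text \<open>The largest member \<open>\<sigma>\<close> of the flag is the support of the image point. Its weight can be read off as well:
some vertex of \<open>\<sigma>\<close> lies in no smaller member, so \<open>y \<sigma> / card \<sigma>\<close> is the least coordinate on \<open>\<sigma>\<close>. Peeling off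
\<open>\<sigma>\<close> leaves a smaller flag, to which induction applies.\<close>
lemma flag_weights_inj:
  assumes "flag_weights y" "flag_weights z" "lin bary y = lin bary z"
  shows "y = z"
  using assms
proof (induction "card (\<Union>(supp y))" arbitrary: y z rule: less_induct)
  case less
  have U: "\<Union>(supp y) = \<Union>(supp z)"
    using supp_lin_bary[OF less.prems(1)] supp_lin_bary[OF less.prems(2)] less.prems(3) by simp
  define \<sigma> where "\<sigma> = \<Union>(supp y)"
  show ?case
  proof (cases "supp y = {}")
    case True
    then have "supp z = {}"
      using U less.prems(2) unfolding flag_weights_def by fastforce
    with True show ?thesis by (auto simp: supp_def fun_eq_iff)
  next
    case False
    then have "supp z \<noteq> {}"
      using U less.prems(1) unfolding flag_weights_def by fastforce
    have peel: "\<Union>(supp (u(\<sigma> := 0))) \<subset> \<sigma> \<and> flag_weights (u(\<sigma> := 0)) \<and>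
        u \<sigma> / card \<sigma> = Min (lin bary u ` \<sigma>) \<and>
        (\<forall>w. lin bary u w = u \<sigma> * bary \<sigma> w + lin bary (u(\<sigma> := 0)) w)"
      if u: "flag_weights u" and ne: "supp u \<noteq> {}" and \<sigma>: "\<sigma> = \<Union>(supp u)" for u
    proof -
      have fin: "finite \<sigma>" using u \<sigma> by (auto simp: flag_weights_def)
      have sub: "supp (u(\<sigma> := 0)) \<subseteq> supp u - {\<sigma>}" by (auto simp: supp_def)
      have fw: "flag_weights (u(\<sigma> := 0))"
        by (rule flag_weights_mono[OF u]) (use u sub in \<open>auto simp: flag_weights_def\<close>)
      have tot: "\<forall>\<sigma>\<in>supp u. \<forall>\<tau>\<in>supp u. \<sigma> \<subseteq> \<tau> \<or> \<tau> \<subseteq> \<sigma>" "finite (supp u)"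
        using u by (simp_all add: flag_weights_def)
      have top: "\<Union>F \<in> F" if F: "F \<subseteq> supp u" "F \<noteq> {}" for F
      proof (rule Union_in_chain[of F UNIV])
        show "subset.chain UNIV F"
          unfolding subset_chain_def using tot(1) F(1) by (meson subsetD subset_UNIV)
      qed (use F finite_subset[OF F(1) tot(2)] in simp_all)
      have "\<sigma> \<in> supp u" using top[OF order_refl ne] \<sigma> by simp
      then have "\<sigma> \<noteq> {}" using u unfolding flag_weights_def by blast
      have "\<Union>(supp (u(\<sigma> := 0))) \<noteq> \<sigma>"
      proof
        assume eq: "\<Union>(supp (u(\<sigma> := 0))) = \<sigma>"
        then have "supp (u(\<sigma> := 0)) \<noteq> {}" using \<open>\<sigma> \<noteq> {}\<close> by auto
        then have "\<sigma> \<in> supp (u(\<sigma> := 0))" using top[of "supp (u(\<sigma> := 0))"] sub eq by auto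
        then show False using sub by blast
      qed
      then have strict: "\<Union>(supp (u(\<sigma> := 0))) \<subset> \<sigma>" using sub \<sigma> by blast
      have eq: "lin bary u w = u \<sigma> * bary \<sigma> w + lin bary (u(\<sigma> := 0)) w" for w
        using lin_fun_upd[of "u(\<sigma> := 0)" \<sigma> bary "u \<sigma>" w] fw by (simp add: flag_weights_def)
      obtain v where v: "v \<in> \<sigma>" "v \<notin> \<Union>(supp (u(\<sigma> := 0)))" using strict by blast
      then have "lin bary (u(\<sigma> := 0)) v = 0"
        using supp_lin_bary[OF fw] by (auto simp: supp_def[of "lin bary _"])
      moreover have "0 \<le> lin bary (u(\<sigma> := 0)) w" for w
        unfolding lin_def using fw by (intro sum_nonneg) (auto simp: flag_weights_def bary_def)
      ultimately have "Min (lin bary u ` \<sigma>) = u \<sigma> / card \<sigma>"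
        using v fin by (intro Min_eqI) (auto simp: eq bary_def intro!: image_eqI[of _ _ v])
      then show ?thesis using strict fw eq by auto
    qed
    note y = peel[OF less.prems(1) False \<sigma>_def]
    note z = peel[OF less.prems(2) \<open>supp z \<noteq> {}\<close> \<sigma>_def[unfolded U]]
    have "\<sigma> \<noteq> {}" "finite \<sigma>"
      using False less.prems(1) by (auto simp: \<sigma>_def flag_weights_def)
    moreover have "y \<sigma> / card \<sigma> = Min (lin bary y ` \<sigma>)" "z \<sigma> / card \<sigma> = Min (lin bary z ` \<sigma>)"
      using y z by blast+
    then have "y \<sigma> / card \<sigma> = z \<sigma> / card \<sigma>"
      using less.prems(3) by simp
    ultimately have eq: "y \<sigma> = z \<sigma>" by simp
    moreover have "lin bary (y(\<sigma> := 0)) = lin bary (z(\<sigma> := 0))"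
    proof
      fix w
      have "lin bary y w = y \<sigma> * bary \<sigma> w + lin bary (y(\<sigma> := 0)) w"
        "lin bary z w = z \<sigma> * bary \<sigma> w + lin bary (z(\<sigma> := 0)) w"
        using y z by blast+
      then show "lin bary (y(\<sigma> := 0)) w = lin bary (z(\<sigma> := 0)) w"
        using less.prems(3) eq by simp
    qed
    moreover have "card (\<Union>(supp (y(\<sigma> := 0)))) < card (\<Union>(supp y))"
      using y \<open>finite \<sigma>\<close> psubset_card_mono unfolding \<sigma>_def by blast
    ultimately have "y(\<sigma> := 0) = z(\<sigma> := 0)"
      using less.hyps y z by blast
    with eq show ?thesis by (metis fun_upd_triv fun_upd_upd)
  qed
qed

lemma sum_lin_bary:
  assumes "flag_weights y"
  shows "sum (lin bary y) (supp (lin bary y)) = sum y (supp y)"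
proof -
  have fin: "finite (\<Union>(supp y))" using assms by (auto simp: flag_weights_def)
  have "sum (lin bary y) (\<Union>(supp y)) = (\<Sum>\<sigma>\<in>supp y. y \<sigma> * sum (bary \<sigma>) (\<Union>(supp y)))"
    unfolding lin_def by (subst sum.swap) (simp add: sum_distrib_left)
  also have "\<dots> = sum y (supp y)"
  proof (rule sum.cong)
    fix \<sigma> assume "\<sigma> \<in> supp y"
    then have "bary \<sigma> \<in> closed_cell (\<Union>(supp y))"
      using assms fin by (intro bary_in_closed_cell) (auto simp: flag_weights_def)
    then show "y \<sigma> * sum (bary \<sigma>) (\<Union>(supp y)) = y \<sigma>"
      by (simp add: closed_cell_def)
  qed simp
  finally show ?thesis using supp_lin_bary[OF assms] by simp
qed

lemma continuous_map_lin_bary: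
  assumes K: "abstract_complex K"
  shows "continuous_map (realization (Sd K)) (realization K) (lin bary)"
proof (rule continuous_map_lin[OF _ K])
  show "abstract_complex (Sd K)"
    by (simp add: Sd_eq_order_complex abstract_complex_order_complex)
  fix c assume c: "c \<in> Sd K"
  then have "\<Union>c \<in> c"
    unfolding Sd_def by (intro Union_in_chain[of c K]) auto
  then have top: "\<Union>c \<in> K" using c by (auto simp: Sd_def subset_chain_def)
  have "bary \<sigma> \<in> closed_cell (\<Union>c)" if "\<sigma> \<in> c" for \<sigma>
  proof (rule bary_in_closed_cell)
    have "\<sigma> \<in> K" using c that by (auto simp: Sd_def subset_chain_def)
    then show "\<sigma> \<noteq> {}" using K abstract_complexD by blast
  qed (use top K abstract_complexD that in auto)
  with top show "\<exists>\<tau>\<in>K. \<forall>\<sigma>\<in>c. bary \<sigma> \<in> closed_cell \<tau>" by blast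
qed

text \<open>The inverse is continuous because the map is closed: over the closed cell of \<open>\<sigma>\<close> lie only the finitely many
closed cells of flags of subsets of \<open>\<sigma>\<close>, and these are compact.\<close>
lemma homeomorphic_map_lin_bary:
  assumes K: "abstract_complex K"
  shows "homeomorphic_map (realization (Sd K)) (realization K) (lin bary)"
proof (rule bijective_closed_imp_homeomorphic_map)
  have SdK: "abstract_complex (Sd K)"
    by (simp add: Sd_eq_order_complex abstract_complex_order_complex)
  show cont: "continuous_map (realization (Sd K)) (realization K) (lin bary)"
    by (rule continuous_map_lin_bary[OF K])
  show "inj_on (lin bary) (topspace (realization (Sd K)))"
    by (rule inj_onI) (auto simp: in_realization_Sd_iff[OF K] intro: flag_weights_inj)
  show "lin bary ` topspace (realization (Sd K)) = topspace (realization K)"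
  proof
    show "lin bary ` topspace (realization (Sd K)) \<subseteq> topspace (realization K)"
      using cont by (auto simp: continuous_map_def)
    show "topspace (realization K) \<subseteq> lin bary ` topspace (realization (Sd K))"
    proof
      fix x assume x: "x \<in> topspace (realization K)"
      then have x': "\<And>v. 0 \<le> x v" "supp x \<in> K" "sum x (supp x) = 1"
        using K by (auto simp: in_realization_iff)
      then obtain y where y: "flag_weights y" "lin bary y = x"
        using ex_flag_weights[of x] abstract_complexD(1)[OF K] by blast
      have "supp y \<subseteq> K"
        using supp_lin_bary[OF y(1)] y x'(2) abstract_complexD(3)[OF K]
        unfolding flag_weights_def by (metis Sup_upper subsetI)
      then have "y \<in> topspace (realization (Sd K))"
        using y x'(3) sum_lin_bary[OF y(1)] by (simp add: in_realization_Sd_iff[OF K])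
      with y show "x \<in> lin bary ` topspace (realization (Sd K))" by blast
    qed
  qed
  show "closed_map (realization (Sd K)) (realization K) (lin bary)"
    unfolding closed_map_def
  proof (intro allI impI)
    fix C assume C: "closedin (realization (Sd K)) C"
    then have C_sub: "C \<subseteq> topspace (realization (Sd K))" by (rule closedin_subset)
    show "closedin (realization K) (lin bary ` C)"
      unfolding closedin_realization[OF K]
    proof (intro conjI ballI)
      show "lin bary ` C \<subseteq> topspace (realization K)"
        using C_sub cont by (auto simp: continuous_map_def)
      fix \<sigma> assume \<sigma>: "\<sigma> \<in> K"
      have fin: "finite \<sigma>" using \<sigma> K abstract_complexD by blast
      let ?F = "{c \<in> Sd K. c \<subseteq> Pow \<sigma>}"
      let ?E = "\<Union>c\<in>?F. lin bary ` (C \<inter> closed_cell c)"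
      have "lin bary ` C \<inter> closed_cell \<sigma> = ?E \<inter> closed_cell \<sigma>"
      proof -
        have "lin bary y \<in> ?E" if y: "y \<in> C" "lin bary y \<in> closed_cell \<sigma>" for y
        proof -
          have "flag_weights y" using y C_sub in_realization_Sd_iff[OF K] by blast
          then have "supp y \<subseteq> Pow \<sigma>"
            using y(2) closed_cell_iff[OF fin] supp_lin_bary by blast
          moreover have "supp y \<in> Sd K" "y \<in> closed_cell (supp y)"
            using y C_sub in_realization_iff[OF SdK] closed_cell_iff abstract_complexD(1)[OF SdK]
            by blast+
          ultimately show ?thesis using y by blast
        qed
        then show ?thesis by auto
      qed
      moreover have "compactin (realization K) ?E"
      proof (intro compactin_Union)
        fix E assume "E \<in> (\<lambda>c. lin bary ` (C \<inter> closed_cell c)) ` ?F"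
        then obtain c where "c \<in> Sd K" "E = lin bary ` (C \<inter> closed_cell c)" by blast
        then show "compactin (realization K) E"
          using image_compactin[OF closed_Int_compactin[OF C compactin_cell[OF SdK]] cont] by simp
      qed (use fin finite_subset[of ?F "Pow (Pow \<sigma>)"] in auto)
      then have "closedin (realization K) ?E"
        by (rule compactin_imp_closedin[OF Hausdorff_realization])
      ultimately show "closed (lin bary ` C \<inter> closed_cell \<sigma>)"
        using closedin_realization_Int_cell[OF K fin] by simp
    qed
  qed
qed

section \<open>Contractible fibres\<close>

lemma homotopy_equivalence_map_compose:
  assumes "homotopy_equivalence_map X Y f" "homotopy_equivalence_map Y Z g"
  shows "homotopy_equivalence_map X Z (g \<circ> f)"
proof -
  obtain f' where f: "continuous_map X Y f" "continuous_map Y X f'"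
    "homotopic_with (\<lambda>_. True) X X (f' \<circ> f) id" "homotopic_with (\<lambda>_. True) Y Y (f \<circ> f') id"
    using assms(1) unfolding homotopy_equivalence_map_def by blast
  obtain g' where g: "continuous_map Y Z g" "continuous_map Z Y g'"
    "homotopic_with (\<lambda>_. True) Y Y (g' \<circ> g) id" "homotopic_with (\<lambda>_. True) Z Z (g \<circ> g') id"
    using assms(2) unfolding homotopy_equivalence_map_def by blast
  have "homotopic_with (\<lambda>_. True) X Y ((g' \<circ> g) \<circ> f) (id \<circ> f)"
    using g(3) f(1) by (rule homotopic_with_compose_continuous_map_right) simp
  then have "homotopic_with (\<lambda>_. True) X X (f' \<circ> ((g' \<circ> g) \<circ> f)) (f' \<circ> (id \<circ> f))"
    using f(2) by (rule homotopic_with_compose_continuous_map_left) simp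
  then have 1: "homotopic_with (\<lambda>_. True) X X ((f' \<circ> g') \<circ> (g \<circ> f)) id"
    using homotopic_with_trans[OF _ f(3)] by (simp add: o_assoc)
  have "homotopic_with (\<lambda>_. True) Z Y ((f \<circ> f') \<circ> g') (id \<circ> g')"
    using f(4) g(2) by (rule homotopic_with_compose_continuous_map_right) simp
  then have "homotopic_with (\<lambda>_. True) Z Z (g \<circ> ((f \<circ> f') \<circ> g')) (g \<circ> (id \<circ> g'))"
    using g(1) by (rule homotopic_with_compose_continuous_map_left) simp
  then have 2: "homotopic_with (\<lambda>_. True) Z Z ((g \<circ> f) \<circ> (f' \<circ> g')) id"
    using homotopic_with_trans[OF _ g(4)] by (simp add: o_assoc)
  show ?thesis
    unfolding homotopy_equivalence_map_def
    using 1 2 continuous_map_compose[OF f(1) g(1)] continuous_map_compose[OF g(2) f(2)] by blast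
qed

lemma homeomorphic_imp_homotopy_equivalence_map:
  assumes "homeomorphic_map X Y f"
  shows "homotopy_equivalence_map X Y f"
proof -
  obtain g where fg: "continuous_map X Y f" "continuous_map Y X g"
    "\<And>x. x \<in> topspace X \<Longrightarrow> g (f x) = x" "\<And>y. y \<in> topspace Y \<Longrightarrow> f (g y) = y"
    using assms unfolding homeomorphic_map_maps homeomorphic_maps_def by blast
  have "homotopic_with (\<lambda>_. True) X X (g \<circ> f) id"
    using fg continuous_map_compose[OF fg(1,2)] by (intro homotopic_with_equal) auto
  moreover have "homotopic_with (\<lambda>_. True) Y Y (f \<circ> g) id"
    using fg continuous_map_compose[OF fg(2,1)] by (intro homotopic_with_equal) auto
  ultimately show ?thesis
    unfolding homotopy_equivalence_map_def using fg by blast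
qed

lemma image_order_complex:
  assumes "c \<in> order_complex le P" "\<And>a. a \<in> P \<Longrightarrow> \<phi> a \<in> Q"
    and "\<And>a b. a \<in> P \<Longrightarrow> b \<in> P \<Longrightarrow> le a b \<Longrightarrow> le' (\<phi> a) (\<phi> b) \<or> le' (\<phi> b) (\<phi> a)"
  shows "\<phi> ` c \<in> order_complex le' Q"
proof -
  have c: "c \<subseteq> P" "finite c" "c \<noteq> {}" "\<And>a b. a \<in> c \<Longrightarrow> b \<in> c \<Longrightarrow> le a b \<or> le b a"
    using assms(1) by (auto simp: order_complex_def)
  have "le' (\<phi> a) (\<phi> b) \<or> le' (\<phi> b) (\<phi> a)" if "a \<in> c" "b \<in> c" for a b
    using c(4)[OF that] assms(3) subsetD[OF c(1)] that by blast
  moreover have "\<phi> ` c \<subseteq> Q" using assms(2) c(1) by blast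
  ultimately show ?thesis
    using c(2,3) by (simp add: order_complex_def)
qed

lemma order_complex_restrict:
  "order_complex le {p \<in> P. Pr p} = {c \<in> order_complex le P. \<forall>p\<in>c. Pr p}"
  unfolding order_complex_def by blast

lemma ex_greatest_in_chain:
  assumes "c \<in> order_complex le P" "transp le"
  shows "\<exists>m\<in>c. \<forall>z\<in>c. le z m"
proof -
  have "finite c" "c \<noteq> {}" "\<forall>a\<in>c. \<forall>b\<in>c. le a b \<or> le b a"
    using assms(1) by (auto simp: order_complex_def)
  then show ?thesis
  proof (induction c rule: finite_ne_induct)
    case (singleton x)
    then show ?case by auto
  next
    case (insert x F)
    then obtain m where m: "m \<in> F" "\<forall>z\<in>F. le z m" by auto
    have xx: "le x x" and "le x m \<or> le m x" using insert.prems m(1) by auto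
    then show ?case
    proof (elim disjE)
      assume "le x m"
      with m show ?thesis by auto
    next
      assume "le m x"
      then have "\<forall>z\<in>F. le z x" using m(2) assms(2) by (meson transpD)
      with xx show ?thesis by auto
    qed
  qed
qed

lemma in_cell_supp:
  assumes "abstract_complex K" "x \<in> topspace (realization K)"
  shows "x \<in> closed_cell (supp x)" "finite (supp x)" "supp x \<in> K"
proof -
  show K: "supp x \<in> K" and fin: "finite (supp x)"
    using assms by (simp_all add: in_realization_iff realization_finite_supp)
  show "x \<in> closed_cell (supp x)"
    using assms closed_cell_iff[OF fin, of x] by (simp add: in_realization_iff)
qed

lemma simplicial_in_closed_cell_supp:
  assumes "abstract_complex K" "x \<in> topspace (realization K)" "finite \<tau>" "\<phi> ` supp x \<subseteq> \<tau>"
  shows "simplicial \<phi> x \<in> closed_cell \<tau>"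
  using simplicial_in_closed_cell[OF _ in_cell_supp(1)] in_cell_supp(2) assms by blast

text \<open>The homotopy inverse is \<open>s\<close> precomposed with the passage to the barycentric subdivision. On the side of \<open>Q\<close>,
the composite is contiguous to the identity because \<open>q (s c)\<close> is a member of the chain \<open>c\<close>. On the side
of \<open>Z\<close>, subdivision and \<open>q\<close> commute up to homotopy, so the composite becomes the subdivision followed by
\<open>\<lambda>d. s (q ` d)\<close> on chains \<open>d\<close> of \<open>Z\<close>. This monotone map and the one sending \<open>d\<close> to its greatest element
\<open>A d\<close> are both bounded by \<open>C\<close>, hence homotopic; and \<open>A\<close> after subdivision is contiguous to
the identity, as \<open>A d\<close> belongs to \<open>d\<close>. The projections to which this is
applied reverse the order, so \<open>q\<close> is assumed to preserve comparability.\<close>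
theorem fibre_homotopy_equivalence:
  fixes le :: "'z \<Rightarrow> 'z \<Rightarrow> bool" and le' :: "'q \<Rightarrow> 'q \<Rightarrow> bool"
    and Z :: "'z set" and Q :: "'q set"
  defines "\<Delta>Z \<equiv> order_complex le Z" and "\<Delta>Q \<equiv> order_complex le' Q"
  assumes trans: "transp le"
    and q: "\<And>z. z \<in> Z \<Longrightarrow> q z \<in> Q"
      "\<And>a b. a \<in> Z \<Longrightarrow> b \<in> Z \<Longrightarrow> le a b \<Longrightarrow> le' (q a) (q b) \<or> le' (q b) (q a)"
    and s: "\<And>c. c \<in> \<Delta>Q \<Longrightarrow> s c \<in> Z" "\<And>c. c \<in> \<Delta>Q \<Longrightarrow> q (s c) \<in> c"
      "\<And>c d. c \<in> \<Delta>Q \<Longrightarrow> d \<in> \<Delta>Q \<Longrightarrow> c \<subseteq> d \<Longrightarrow> le (s c) (s d)"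
    and C: "\<And>d. d \<in> \<Delta>Z \<Longrightarrow> C d \<in> Z"
      "\<And>d e. d \<in> \<Delta>Z \<Longrightarrow> e \<in> \<Delta>Z \<Longrightarrow> d \<subseteq> e \<Longrightarrow> le (C d) (C e)"
      "\<And>d z. d \<in> \<Delta>Z \<Longrightarrow> z \<in> d \<Longrightarrow> le z (C d)"
      "\<And>d. d \<in> \<Delta>Z \<Longrightarrow> le (s (q ` d)) (C d)"
  shows "homotopy_equivalence_map (realization \<Delta>Z) (realization \<Delta>Q) (simplicial q)"
proof -
  have Z: "abstract_complex \<Delta>Z" and Q: "abstract_complex \<Delta>Q"
    by (simp_all add: \<Delta>Z_def \<Delta>Q_def abstract_complex_order_complex)
  have SZ: "abstract_complex (Sd \<Delta>Z)" and SQ: "abstract_complex (Sd \<Delta>Q)"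
    by (simp_all add: Sd_eq_order_complex abstract_complex_order_complex)
  obtain bQ where bQ: "continuous_map (realization \<Delta>Q) (realization (Sd \<Delta>Q)) bQ"
    "\<And>y. y \<in> topspace (realization (Sd \<Delta>Q)) \<Longrightarrow> bQ (lin bary y) = y"
    "\<And>x. x \<in> topspace (realization \<Delta>Q) \<Longrightarrow> lin bary (bQ x) = x"
    using homeomorphic_map_lin_bary[OF Q] unfolding homeomorphic_map_maps homeomorphic_maps_def by blast
  obtain bZ where bZ: "continuous_map (realization \<Delta>Z) (realization (Sd \<Delta>Z)) bZ"
    "\<And>x. x \<in> topspace (realization \<Delta>Z) \<Longrightarrow> lin bary (bZ x) = x"
    using homeomorphic_map_lin_bary[OF Z] unfolding homeomorphic_map_maps homeomorphic_maps_def by blast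
  have supp_bQ: "\<Union>(supp (bQ x)) = supp x" "supp (bQ x) \<subseteq> \<Delta>Q" "bQ x \<in> topspace (realization (Sd \<Delta>Q))"
    if x: "x \<in> topspace (realization \<Delta>Q)" for x
  proof -
    show in_Sd: "bQ x \<in> topspace (realization (Sd \<Delta>Q))"
      using bQ(1) x unfolding continuous_map_def by blast
    then show "\<Union>(supp (bQ x)) = supp x" "supp (bQ x) \<subseteq> \<Delta>Q"
      using supp_lin_bary[of "bQ x"] bQ(3)[OF x] by (simp_all add: in_realization_Sd_iff[OF Q])
  qed
  have supp_bZ: "\<Union>(supp (bZ x)) = supp x" "supp (bZ x) \<subseteq> \<Delta>Z" "bZ x \<in> topspace (realization (Sd \<Delta>Z))"
    if x: "x \<in> topspace (realization \<Delta>Z)" for x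
  proof -
    show in_Sd: "bZ x \<in> topspace (realization (Sd \<Delta>Z))"
      using bZ(1) x unfolding continuous_map_def by blast
    then show "\<Union>(supp (bZ x)) = supp x" "supp (bZ x) \<subseteq> \<Delta>Z"
      using supp_lin_bary[of "bZ x"] bZ(2)[OF x] by (simp_all add: in_realization_Sd_iff[OF Z])
  qed
  have q_simplex: "q ` d \<in> \<Delta>Q" if "d \<in> \<Delta>Z" for d
    using that q unfolding \<Delta>Z_def \<Delta>Q_def by (rule image_order_complex)
  have s_simplex: "s ` c \<in> \<Delta>Z" if "c \<in> Sd \<Delta>Q" for c
    unfolding \<Delta>Z_def
    by (rule image_order_complex[OF that[unfolded Sd_eq_order_complex]])
      (intro disjI1 s(1,3); assumption)+
  have qq_simplex: "(`) q ` e \<in> Sd \<Delta>Q" if "e \<in> Sd \<Delta>Z" for e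
    unfolding Sd_eq_order_complex
    by (rule image_order_complex[OF that[unfolded Sd_eq_order_complex]])
      (intro disjI1 image_mono q_simplex; assumption)+
  have cq: "continuous_map (realization \<Delta>Z) (realization \<Delta>Q) (simplicial q)"
    by (rule continuous_map_simplicial[OF Z Q q_simplex])
  have cs: "continuous_map (realization (Sd \<Delta>Q)) (realization \<Delta>Z) (simplicial s)"
    by (rule continuous_map_simplicial[OF SQ Z s_simplex])
  have cqq: "continuous_map (realization (Sd \<Delta>Z)) (realization (Sd \<Delta>Q)) (simplicial ((`) q))"
    by (rule continuous_map_simplicial[OF SZ SQ qq_simplex])
  have csb: "continuous_map (realization \<Delta>Q) (realization \<Delta>Z) (simplicial s \<circ> bQ)"
    by (rule continuous_map_compose[OF bQ(1) cs])
  let ?hom = "\<lambda>X Y. homotopic_with (\<lambda>_. True) (realization X) (realization Y)"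

  have "?hom \<Delta>Q \<Delta>Q (simplicial q \<circ> (simplicial s \<circ> bQ)) id"
  proof (rule homotopic_contiguous[OF Q Q continuous_map_compose[OF csb cq]])
    fix x assume x: "x \<in> topspace (realization \<Delta>Q)"
    have z: "simplicial s (bQ x) \<in> topspace (realization \<Delta>Z)"
      using csb x unfolding continuous_map_def by auto
    have "q ` supp (simplicial s (bQ x)) \<subseteq> q ` s ` supp (bQ x)"
      by (intro image_mono supp_simplicial)
    also have "\<dots> \<subseteq> supp x"
    proof (clarify)
      fix c assume c: "c \<in> supp (bQ x)"
      then have "q (s c) \<in> c" using supp_bQ(2)[OF x] s(2) by blast
      with c show "q (s c) \<in> supp x" using supp_bQ(1)[OF x] by blast
    qed
    finally have "simplicial q (simplicial s (bQ x)) \<in> closed_cell (supp x)"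
      by (intro simplicial_in_closed_cell_supp[OF Z z] in_cell_supp(2)[OF Q x])
    then show "\<exists>\<tau>\<in>\<Delta>Q. (simplicial q \<circ> (simplicial s \<circ> bQ)) x \<in> closed_cell \<tau> \<and> id x \<in> closed_cell \<tau>"
      using in_cell_supp[OF Q x] by auto
  qed simp
  moreover have "?hom \<Delta>Z \<Delta>Z ((simplicial s \<circ> bQ) \<circ> simplicial q) id"
  proof -
    \<comment> \<open>Subdivision is not natural for simplicial maps that identify vertices. The two ways around the
      square agree up to contiguity after \<open>lin bary\<close>, and this homeomorphism can be undone.\<close>
    have "?hom \<Delta>Z \<Delta>Q (lin bary \<circ> (bQ \<circ> simplicial q)) (lin bary \<circ> (simplicial ((`) q) \<circ> bZ))"
    proof (rule homotopic_contiguous[OF Z Q])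
      show "continuous_map (realization \<Delta>Z) (realization \<Delta>Q) (lin bary \<circ> (bQ \<circ> simplicial q))"
        by (intro continuous_map_compose[OF _ continuous_map_lin_bary[OF Q]]
            continuous_map_compose[OF cq bQ(1)])
      show "continuous_map (realization \<Delta>Z) (realization \<Delta>Q) (lin bary \<circ> (simplicial ((`) q) \<circ> bZ))"
        by (intro continuous_map_compose[OF _ continuous_map_lin_bary[OF Q]]
            continuous_map_compose[OF bZ(1) cqq])
      fix z assume z: "z \<in> topspace (realization \<Delta>Z)"
      let ?\<tau> = "q ` supp z"
      have fin: "finite ?\<tau>" using in_cell_supp(2)[OF Z z] by simp
      have "simplicial q z \<in> topspace (realization \<Delta>Q)"
        using cq z unfolding continuous_map_def by blast
      then have "(lin bary \<circ> (bQ \<circ> simplicial q)) z = simplicial q z"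
        using bQ(3) by simp
      then have 1: "(lin bary \<circ> (bQ \<circ> simplicial q)) z \<in> closed_cell ?\<tau>"
        using simplicial_in_closed_cell_supp[OF Z z fin] by simp
      define w where "w = simplicial ((`) q) (bZ z)"
      have "w \<in> topspace (realization (Sd \<Delta>Q))"
        using cqq supp_bZ(3)[OF z] unfolding continuous_map_def w_def by blast
      note w = in_cell_supp[OF SQ this]
      have "bary c \<in> closed_cell ?\<tau>" if c: "c \<in> supp w" for c
      proof -
        obtain d where d: "d \<in> supp (bZ z)" "c = q ` d"
          using c supp_simplicial[of "(`) q" "bZ z"] unfolding w_def by blast
        then have "d \<noteq> {}" "d \<subseteq> supp z"
          using supp_bZ[OF z] abstract_complexD(2)[OF Z] by blast+
        then show ?thesis
          unfolding d(2) by (intro bary_in_closed_cell[OF fin]) auto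
      qed
      then have "lin bary w \<in> closed_cell ?\<tau>"
        by (rule lin_in_closed_cell[OF w(2,1)])
      with 1 show "\<exists>\<tau>\<in>\<Delta>Q. (lin bary \<circ> (bQ \<circ> simplicial q)) z \<in> closed_cell \<tau> \<and>
          (lin bary \<circ> (simplicial ((`) q) \<circ> bZ)) z \<in> closed_cell \<tau>"
        using q_simplex[OF in_cell_supp(3)[OF Z z]] by (auto simp: w_def)
    qed
    from homotopic_with_compose_continuous_map_left[OF this csb, of "\<lambda>_. True"]
    have "?hom \<Delta>Z \<Delta>Z ((simplicial s \<circ> bQ) \<circ> (lin bary \<circ> (bQ \<circ> simplicial q)))
        ((simplicial s \<circ> bQ) \<circ> (lin bary \<circ> (simplicial ((`) q) \<circ> bZ)))"
      by simp
    then have 1: "?hom \<Delta>Z \<Delta>Z ((simplicial s \<circ> bQ) \<circ> simplicial q)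
        ((simplicial s \<circ> simplicial ((`) q)) \<circ> bZ)"
    proof (rule homotopic_with_eq)
      fix z assume z: "z \<in> topspace (realization \<Delta>Z)"
      have "bQ (simplicial q z) \<in> topspace (realization (Sd \<Delta>Q))"
        using cq z supp_bQ(3) unfolding continuous_map_def by blast
      then show "((simplicial s \<circ> bQ) \<circ> simplicial q) z =
          ((simplicial s \<circ> bQ) \<circ> (lin bary \<circ> (bQ \<circ> simplicial q))) z"
        using bQ(2) by simp
      have "simplicial ((`) q) (bZ z) \<in> topspace (realization (Sd \<Delta>Q))"
        using cqq supp_bZ(3)[OF z] unfolding continuous_map_def by blast
      then show "((simplicial s \<circ> simplicial ((`) q)) \<circ> bZ) z =
          ((simplicial s \<circ> bQ) \<circ> (lin bary \<circ> (simplicial ((`) q) \<circ> bZ))) z"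
        using bQ(2) by simp
    qed simp
    have sq_simplex: "(\<lambda>d. s (q ` d)) ` e \<in> \<Delta>Z" if "e \<in> Sd \<Delta>Z" for e
      using s_simplex[OF qq_simplex[OF that]] by (simp add: image_image)
    have 2: "?hom (Sd \<Delta>Z) \<Delta>Z (simplicial s \<circ> simplicial ((`) q)) (simplicial (\<lambda>d. s (q ` d)))"
    proof (rule homotopic_contiguous[OF SZ Z continuous_map_compose[OF cqq cs]])
      show "continuous_map (realization (Sd \<Delta>Z)) (realization \<Delta>Z) (simplicial (\<lambda>d. s (q ` d)))"
        by (rule continuous_map_simplicial[OF SZ Z sq_simplex])
      fix w assume w: "w \<in> topspace (realization (Sd \<Delta>Z))"
      let ?\<tau> = "(\<lambda>d. s (q ` d)) ` supp w"
      have fin: "finite ?\<tau>" using in_cell_supp(2)[OF SZ w] by simp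
      have "simplicial ((`) q) w \<in> topspace (realization (Sd \<Delta>Q))"
        using cqq w unfolding continuous_map_def by blast
      moreover have "s ` supp (simplicial ((`) q) w) \<subseteq> s ` (`) q ` supp w"
        by (intro image_mono supp_simplicial)
      then have "s ` supp (simplicial ((`) q) w) \<subseteq> ?\<tau>" by (simp add: image_image)
      ultimately have "simplicial s (simplicial ((`) q) w) \<in> closed_cell ?\<tau>"
        by (intro simplicial_in_closed_cell_supp[OF SQ _ fin])
      moreover have "simplicial (\<lambda>d. s (q ` d)) w \<in> closed_cell ?\<tau>"
        by (rule simplicial_in_closed_cell_supp[OF SZ w fin]) simp
      ultimately show "\<exists>\<tau>\<in>\<Delta>Z. (simplicial s \<circ> simplicial ((`) q)) w \<in> closed_cell \<tau> \<and>
          simplicial (\<lambda>d. s (q ` d)) w \<in> closed_cell \<tau>"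
        using sq_simplex[OF in_cell_supp(3)[OF SZ w]] by auto
    qed
    have mono_sq: "le (s (q ` d)) (s (q ` e))" if "d \<in> \<Delta>Z" "e \<in> \<Delta>Z" "d \<subseteq> e" for d e
      using that s(3) q_simplex by (simp add: image_mono)
    have 3: "?hom (Sd \<Delta>Z) \<Delta>Z (simplicial (\<lambda>d. s (q ` d))) (simplicial C)"
      unfolding Sd_eq_order_complex \<Delta>Z_def
      by (rule homotopic_simplicial_mono)
        (use C s(1) q_simplex mono_sq trans in \<open>auto simp flip: \<Delta>Z_def\<close>)
    have "\<forall>d\<in>\<Delta>Z. \<exists>m\<in>d. \<forall>z\<in>d. le z m"
      using ex_greatest_in_chain[OF _ trans] unfolding \<Delta>Z_def by blast
    then obtain A where A: "\<And>d. d \<in> \<Delta>Z \<Longrightarrow> A d \<in> d" "\<And>d z. d \<in> \<Delta>Z \<Longrightarrow> z \<in> d \<Longrightarrow> le z (A d)"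
      by metis
    have A_Z: "A d \<in> Z" if "d \<in> \<Delta>Z" for d
      using A(1)[OF that] that unfolding \<Delta>Z_def order_complex_def by blast
    have mono_A: "le (A d) (A e)" if "d \<in> \<Delta>Z" "e \<in> \<Delta>Z" "d \<subseteq> e" for d e
      using A that by blast
    have 4: "?hom (Sd \<Delta>Z) \<Delta>Z (simplicial A) (simplicial C)"
      unfolding Sd_eq_order_complex \<Delta>Z_def
      by (rule homotopic_simplicial_mono)
        (use C A A_Z mono_A trans in \<open>auto simp flip: \<Delta>Z_def\<close>)
    then have cA: "continuous_map (realization (Sd \<Delta>Z)) (realization \<Delta>Z) (simplicial A)"
      using homotopic_with_imp_continuous_maps by blast
    have 5: "?hom \<Delta>Z \<Delta>Z (simplicial A \<circ> bZ) id"
    proof (rule homotopic_contiguous[OF Z Z continuous_map_compose[OF bZ(1) cA]])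
      fix z assume z: "z \<in> topspace (realization \<Delta>Z)"
      have "A ` supp (bZ z) \<subseteq> supp z"
        using supp_bZ(1,2)[OF z] A(1) by blast
      then have "simplicial A (bZ z) \<in> closed_cell (supp z)"
        by (rule simplicial_in_closed_cell_supp[OF SZ supp_bZ(3)[OF z] in_cell_supp(2)[OF Z z]])
      then show "\<exists>\<tau>\<in>\<Delta>Z. (simplicial A \<circ> bZ) z \<in> closed_cell \<tau> \<and> id z \<in> closed_cell \<tau>"
        using in_cell_supp[OF Z z] by auto
    qed simp
    have "?hom (Sd \<Delta>Z) \<Delta>Z (simplicial s \<circ> simplicial ((`) q)) (simplicial A)"
      using homotopic_with_trans[OF homotopic_with_trans[OF 2 3]] 4 by (simp add: homotopic_with_sym)
    from homotopic_with_compose_continuous_map_right[OF this bZ(1), of "\<lambda>_. True"]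
    have "?hom \<Delta>Z \<Delta>Z ((simplicial s \<circ> simplicial ((`) q)) \<circ> bZ) (simplicial A \<circ> bZ)"
      by simp
    from homotopic_with_trans[OF homotopic_with_trans[OF 1 this] 5] show ?thesis .
  qed
  ultimately show ?thesis
    unfolding homotopy_equivalence_map_def using cq csb by blast
qed

section \<open>Rectangles in a relation\<close>

lemma Union_mem_of_Un_closed:
  assumes "finite F" "F \<noteq> {}" "F \<subseteq> B" "\<And>a b. a \<in> B \<Longrightarrow> b \<in> B \<Longrightarrow> a \<union> b \<in> B"
  shows "\<Union>F \<in> B"
  using assms(1-3) by (induction F rule: finite_ne_induct) (auto intro: assms(4))

definition rectangles :: "'a set \<Rightarrow> 'b set \<Rightarrow> ('a \<times> 'b) set \<Rightarrow> real \<Rightarrow> ('a set \<times> 'b set) set" where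
  "rectangles X Y R m = {(\<sigma>, \<tau>). \<sigma> \<subseteq> X \<and> finite \<sigma> \<and> \<sigma> \<noteq> {} \<and>
     \<tau> \<subseteq> Y \<and> finite \<tau> \<and> \<tau> \<noteq> {} \<and> m \<le> card \<tau> \<and> \<sigma> \<times> \<tau> \<subseteq> R}"

lemma rectangles_mono: "m' \<le> m \<Longrightarrow> R \<subseteq> R' \<Longrightarrow> rectangles X Y R m \<subseteq> rectangles X Y R' m'"
  unfolding rectangles_def by fastforce

text \<open>A set of witnesses with at least \<open>m\<close> elements contains a finite one, also when it is infinite. Positivity of \<open>m\<close> makes that finite set
non-empty.\<close>
lemma dowker_weight_eq:
  assumes "0 < m"
  shows "dowker_weight X Y R m = fst ` rectangles X Y R m"
proof -
  have "ereal m \<le> ereal_of_enat (total_weight Y R \<sigma>) \<longleftrightarrow>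
      (\<exists>\<tau>\<subseteq>Y. finite \<tau> \<and> m \<le> card \<tau> \<and> \<sigma> \<times> \<tau> \<subseteq> R)" (is "?L \<longleftrightarrow> ?R") for \<sigma>
  proof -
    define W where "W = {y\<in>Y. \<sigma> \<times> {y} \<subseteq> R}"
    have sub_W: "\<tau> \<subseteq> Y \<and> \<sigma> \<times> \<tau> \<subseteq> R \<longleftrightarrow> \<tau> \<subseteq> W" for \<tau>
      unfolding W_def by blast
    have "?L \<longleftrightarrow> (\<exists>\<tau>\<subseteq>W. finite \<tau> \<and> m \<le> card \<tau>)"
    proof (cases "finite W")
      case True
      then have "?L \<longleftrightarrow> m \<le> card W"
        by (simp add: total_weight_def W_def)
      also have "\<dots> \<longleftrightarrow> (\<exists>\<tau>\<subseteq>W. finite \<tau> \<and> m \<le> card \<tau>)"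
        using True card_mono[OF True] by (metis of_nat_le_iff order_refl order_trans)
      finally show ?thesis .
    next
      case False
      then obtain \<tau> where \<tau>: "\<tau> \<subseteq> W" "finite \<tau>" "card \<tau> = nat \<lceil>m\<rceil>"
        using infinite_arbitrarily_large by blast
      then have "m \<le> card \<tau>" by linarith
      with \<tau> have "\<exists>\<tau>\<subseteq>W. finite \<tau> \<and> m \<le> card \<tau>" by blast
      moreover have ?L
        using False by (simp add: total_weight_def W_def)
      ultimately show ?thesis by simp
    qed
    also have "\<dots> \<longleftrightarrow> (\<exists>\<tau>. (\<tau> \<subseteq> Y \<and> \<sigma> \<times> \<tau> \<subseteq> R) \<and> finite \<tau> \<and> m \<le> card \<tau>)"
      by (simp only: sub_W)
    also have "\<dots> \<longleftrightarrow> ?R" by iprover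
    finally show ?thesis .
  qed
  note weight = this
  show ?thesis
  proof
    show "dowker_weight X Y R m \<subseteq> fst ` rectangles X Y R m"
    proof
      fix \<sigma> assume "\<sigma> \<in> dowker_weight X Y R m"
      then have \<sigma>: "\<sigma> \<subseteq> X" "finite \<sigma>" "\<sigma> \<noteq> {}"
        and "ereal m \<le> ereal_of_enat (total_weight Y R \<sigma>)"
        by (simp_all add: dowker_weight_def dowker_def)
      then obtain \<tau> where \<tau>: "\<tau> \<subseteq> Y" "finite \<tau>" "m \<le> card \<tau>" "\<sigma> \<times> \<tau> \<subseteq> R"
        using weight by blast
      then have "\<tau> \<noteq> {}" using assms by auto
      with \<sigma> \<tau> have "(\<sigma>, \<tau>) \<in> rectangles X Y R m" by (simp add: rectangles_def)
      then show "\<sigma> \<in> fst ` rectangles X Y R m" by (rule image_eqI[rotated]) simp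
    qed
    show "fst ` rectangles X Y R m \<subseteq> dowker_weight X Y R m"
    proof clarsimp
      fix \<sigma> \<tau> assume "(\<sigma>, \<tau>) \<in> rectangles X Y R m"
      then have *: "\<sigma> \<subseteq> X" "finite \<sigma>" "\<sigma> \<noteq> {}" "\<tau> \<subseteq> Y" "finite \<tau>" "\<tau> \<noteq> {}" "m \<le> card \<tau>" "\<sigma> \<times> \<tau> \<subseteq> R"
        by (simp_all add: rectangles_def)
      then obtain y where "y \<in> Y" "\<sigma> \<times> {y} \<subseteq> R" by blast
      then have "\<sigma> \<in> dowker X Y R" using * unfolding dowker_def by blast
      moreover have "ereal m \<le> ereal_of_enat (total_weight Y R \<sigma>)"
        using weight * by blast
      ultimately show "\<sigma> \<in> dowker_weight X Y R m" by (simp add: dowker_weight_def)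
    qed
  qed
qed

text \<open>The smallest member of a flag has at least \<open>m\<close> vertices iff all of its members do.\<close>
lemma subdivision_filtration_eq:
  "subdivision_filtration (dowker Y X (R\<inverse>)) m = Sd (snd ` rectangles X Y R m)"
proof -
  let ?K = "dowker Y X (R\<inverse>)"
  have K: "finite \<tau>" if "\<tau> \<in> ?K" for \<tau> using that by (simp add: dowker_def)
  have snd: "snd ` rectangles X Y R m = {\<tau> \<in> ?K. m \<le> card \<tau>}"
  proof
    show "snd ` rectangles X Y R m \<subseteq> {\<tau> \<in> ?K. m \<le> card \<tau>}"
    proof clarsimp
      fix \<sigma> \<tau> assume "(\<sigma>, \<tau>) \<in> rectangles X Y R m"
      then have *: "\<sigma> \<subseteq> X" "\<sigma> \<noteq> {}" "\<tau> \<subseteq> Y" "finite \<tau>" "\<tau> \<noteq> {}" "m \<le> card \<tau>" "\<sigma> \<times> \<tau> \<subseteq> R"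
        by (simp_all add: rectangles_def)
      then obtain x where "x \<in> X" "\<tau> \<times> {x} \<subseteq> R\<inverse>" by blast
      with * show "\<tau> \<in> ?K \<and> m \<le> card \<tau>" unfolding dowker_def by blast
    qed
    show "{\<tau> \<in> ?K. m \<le> card \<tau>} \<subseteq> snd ` rectangles X Y R m"
    proof clarify
      fix \<tau> assume \<tau>: "\<tau> \<in> ?K" "m \<le> card \<tau>"
      then obtain x where "x \<in> X" "\<tau> \<times> {x} \<subseteq> R\<inverse>" unfolding dowker_def by blast
      with \<tau> have "({x}, \<tau>) \<in> rectangles X Y R m"
        unfolding dowker_def rectangles_def by blast
      then show "\<tau> \<in> snd ` rectangles X Y R m" by force
    qed
  qed
  have "(\<exists>\<sigma>\<^sub>0\<in>c. (\<forall>\<sigma>\<in>c. \<sigma>\<^sub>0 \<subseteq> \<sigma>) \<and> m - 1 \<le> real_of_int (simplex_dim \<sigma>\<^sub>0)) \<longleftrightarrow> (\<forall>\<sigma>\<in>c. m \<le> card \<sigma>)"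
    if c: "c \<in> Sd ?K" for c
  proof
    assume "\<exists>\<sigma>\<^sub>0\<in>c. (\<forall>\<sigma>\<in>c. \<sigma>\<^sub>0 \<subseteq> \<sigma>) \<and> m - 1 \<le> real_of_int (simplex_dim \<sigma>\<^sub>0)"
    then obtain \<sigma>\<^sub>0 where \<sigma>\<^sub>0: "\<forall>\<sigma>\<in>c. \<sigma>\<^sub>0 \<subseteq> \<sigma>" "m \<le> card \<sigma>\<^sub>0"
      by (auto simp: simplex_dim_def)
    show "\<forall>\<sigma>\<in>c. m \<le> card \<sigma>"
    proof
      fix \<sigma> assume \<sigma>: "\<sigma> \<in> c"
      then have "finite \<sigma>" using c K by (auto simp: Sd_def subset_chain_def)
      then have "card \<sigma>\<^sub>0 \<le> card \<sigma>" using \<sigma>\<^sub>0(1) \<sigma> by (simp add: card_mono)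
      with \<sigma>\<^sub>0(2) show "m \<le> card \<sigma>" by linarith
    qed
  next
    assume "\<forall>\<sigma>\<in>c. m \<le> card \<sigma>"
    moreover have "\<Inter>c \<in> c" using c unfolding Sd_def by (intro Inter_in_chain[of c ?K]) auto
    ultimately show "\<exists>\<sigma>\<^sub>0\<in>c. (\<forall>\<sigma>\<in>c. \<sigma>\<^sub>0 \<subseteq> \<sigma>) \<and> m - 1 \<le> real_of_int (simplex_dim \<sigma>\<^sub>0)"
      by (intro bexI[of _ "\<Inter>c"]) (auto simp: simplex_dim_def)
  qed
  then have "subdivision_filtration ?K m = {c \<in> Sd ?K. \<forall>\<sigma>\<in>c. m \<le> card \<sigma>}"
    unfolding subdivision_filtration_def by blast
  also have "\<dots> = Sd {\<tau> \<in> ?K. m \<le> card \<tau>}"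
    by (simp only: Sd_eq_order_complex order_complex_restrict)
  finally show ?thesis by (simp add: snd)
qed

text \<open>The order is reversed on first sides because the rectangle built from a flag of first sides loses
points there while it gains points on the other side, as the flag grows.\<close>
definition twisted_le :: "'a set \<times> 'b set \<Rightarrow> 'a set \<times> 'b set \<Rightarrow> bool" where
  "twisted_le z z' \<longleftrightarrow> fst z' \<subseteq> fst z \<and> snd z \<subseteq> snd z'"

lemma Inter_times_Union_subset:
  assumes "\<And>i. i \<in> I \<Longrightarrow> f i \<times> g i \<subseteq> R"
  shows "\<Inter>(f ` I) \<times> \<Union>(g ` I) \<subseteq> R"
proof
  fix u assume "u \<in> \<Inter>(f ` I) \<times> \<Union>(g ` I)"
  then obtain i where "i \<in> I" "u \<in> f i \<times> g i" by auto
  with assms show "u \<in> R" by blast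
qed

text \<open>The side that \<open>p\<close> projects to and the way in which pairs are formed are left open so that both
projections of the rectangles are covered. Closure of \<open>B\<close> under unions makes each fibre of \<open>p\<close>
directed, which is the form in which its contractibility enters.\<close>
lemma projection_homotopy_equivalence:
  fixes p :: "'z \<Rightarrow> 's set" and q :: "'z \<Rightarrow> 't set" and mk :: "'s set \<Rightarrow> 't set \<Rightarrow> 'z"
  assumes mk: "\<And>\<sigma> \<tau>. p (mk \<sigma> \<tau>) = \<sigma>" "\<And>\<sigma> \<tau>. q (mk \<sigma> \<tau>) = \<tau>"
    and Z: "\<And>z. z \<in> Z \<Longrightarrow> p z \<in> A \<and> q z \<in> B \<and> p z \<times> q z \<subseteq> R"
      "\<And>\<sigma> \<tau>. \<sigma> \<in> A \<Longrightarrow> \<tau> \<in> B \<Longrightarrow> \<sigma> \<times> \<tau> \<subseteq> R \<Longrightarrow> mk \<sigma> \<tau> \<in> Z"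
    and B: "\<And>\<tau> \<tau>'. \<tau> \<in> B \<Longrightarrow> \<tau>' \<in> B \<Longrightarrow> \<tau> \<union> \<tau>' \<in> B"
    and le: "\<And>z z'. le z z' \<longleftrightarrow> p z' \<subseteq> p z \<and> q z \<subseteq> q z'"
  shows "homotopy_equivalence_map (realization (order_complex le Z))
    (realization (Sd (p ` Z))) (simplicial p)"
proof -
  have "\<forall>\<sigma>\<in>p ` Z. \<exists>\<tau>. \<tau> \<in> B \<and> \<sigma> \<times> \<tau> \<subseteq> R" using Z(1) by blast
  then obtain w where w: "\<And>\<sigma>. \<sigma> \<in> p ` Z \<Longrightarrow> w \<sigma> \<in> B" "\<And>\<sigma>. \<sigma> \<in> p ` Z \<Longrightarrow> \<sigma> \<times> w \<sigma> \<subseteq> R"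
    by metis
  \<comment> \<open>Only the smallest member of a flag is known to be related to all the chosen \<open>w \<sigma>\<close>.\<close>
  define s where "s c = mk (\<Inter>c) (\<Union>(w ` c))" for c
  define C where "C d = mk (\<Inter>(p ` d)) (\<Union>(q ` d) \<union> \<Union>(w ` p ` d))" for d
  have chain: "\<Inter>c \<in> c" "\<Inter>c \<in> A" "\<Union>(w ` c) \<in> B" "\<Inter>c \<times> \<Union>(w ` c) \<subseteq> R"
    if c: "c \<in> order_complex (\<subseteq>) (p ` Z)" for c
  proof -
    have c': "finite c" "c \<noteq> {}" "c \<subseteq> p ` Z" "subset.chain (p ` Z) c"
      using c by (simp_all add: order_complex_def subset_chain_def)
    show "\<Inter>c \<in> c" by (rule Inter_in_chain[OF c'(1,2,4)])
    then have "\<Inter>c \<in> p ` Z" by (rule subsetD[OF c'(3)])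
    then show "\<Inter>c \<in> A" using Z(1) by (elim imageE) simp
    show "\<Union>(w ` c) \<in> B"
      by (rule Union_mem_of_Un_closed) (use c' w(1) B in auto)
    have "\<sigma> \<times> w \<sigma> \<subseteq> R" if "\<sigma> \<in> c" for \<sigma> using that c'(3) w(2) by blast
    then show "\<Inter>c \<times> \<Union>(w ` c) \<subseteq> R"
      using Inter_times_Union_subset[of c "\<lambda>\<sigma>. \<sigma>" w] by simp
  qed
  have p_chain: "p ` d \<in> order_complex (\<subseteq>) (p ` Z)" if "d \<in> order_complex le Z" for d
    using that by (rule image_order_complex) (auto simp: le)
  have C_Z: "C d \<in> Z" if d: "d \<in> order_complex le Z" for d
  proof -
    have d': "finite d" "d \<noteq> {}" "d \<subseteq> Z" using d by (simp_all add: order_complex_def)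
    have "\<Union>(q ` d) \<in> B"
      by (rule Union_mem_of_Un_closed) (use d' Z(1) B in auto)
    moreover have "p z \<times> q z \<subseteq> R" if "z \<in> d" for z using that d'(3) Z(1) by blast
    then have "\<Inter>(p ` d) \<times> \<Union>(q ` d) \<subseteq> R" by (rule Inter_times_Union_subset)
    ultimately show ?thesis
      unfolding C_def using chain[OF p_chain[OF d]]
      by (intro Z(2) B) (simp_all add: Sigma_Un_distrib2)
  qed
  show ?thesis
    unfolding Sd_eq_order_complex
  proof (rule fibre_homotopy_equivalence[where s = s and C = C])
    show "transp le" unfolding transp_def le by blast
    fix c assume c: "c \<in> order_complex (\<subseteq>) (p ` Z)"
    show "s c \<in> Z" unfolding s_def using chain[OF c] by (intro Z(2))
    show "p (s c) \<in> c" unfolding s_def mk by (rule chain(1)[OF c])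
    fix d assume "c \<subseteq> d"
    then show "le (s c) (s d)" unfolding s_def le mk by blast
  next
    fix d e :: "'z set" assume "d \<subseteq> e"
    then show "le (C d) (C e)" unfolding C_def le mk by blast
  next
    fix d and z :: 'z assume "z \<in> d"
    then show "le z (C d)" unfolding C_def le mk by blast
  next
    fix d show "le (s (p ` d)) (C d)" unfolding s_def C_def le mk by blast
  qed (auto simp: le C_Z)
qed

lemma fst_rectangles_homotopy_equivalence:
  "homotopy_equivalence_map (realization (order_complex twisted_le (rectangles X Y R m)))
    (realization (Sd (fst ` rectangles X Y R m))) (simplicial fst)"
  by (rule projection_homotopy_equivalence[where q = snd and mk = Pair
        and A = "{\<sigma>. \<sigma> \<subseteq> X \<and> finite \<sigma> \<and> \<sigma> \<noteq> {}}"
        and B = "{\<tau>. \<tau> \<subseteq> Y \<and> finite \<tau> \<and> \<tau> \<noteq> {} \<and> m \<le> card \<tau>}" and R = R])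
    (auto simp: rectangles_def twisted_le_def intro: order_trans[OF _ of_nat_mono[OF card_mono]])

text \<open>Exchanging the sides turns \<open>twisted_le\<close> into its converse, which has the same chains.\<close>
lemma snd_rectangles_homotopy_equivalence:
  "homotopy_equivalence_map (realization (order_complex twisted_le (rectangles X Y R m)))
    (realization (Sd (snd ` rectangles X Y R m))) (simplicial snd)"
proof -
  have "order_complex twisted_le (rectangles X Y R m) =
      order_complex (\<lambda>z z'. twisted_le z' z) (rectangles X Y R m)"
    unfolding order_complex_def by blast
  moreover have "homotopy_equivalence_map
      (realization (order_complex (\<lambda>z z'. twisted_le z' z) (rectangles X Y R m)))
      (realization (Sd (snd ` rectangles X Y R m))) (simplicial snd)"
    by (rule projection_homotopy_equivalence[where q = fst and mk = "\<lambda>\<tau> \<sigma>. (\<sigma>, \<tau>)"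
          and A = "{\<tau>. \<tau> \<subseteq> Y \<and> finite \<tau> \<and> \<tau> \<noteq> {} \<and> m \<le> card \<tau>}"
          and B = "{\<sigma>. \<sigma> \<subseteq> X \<and> finite \<sigma> \<and> \<sigma> \<noteq> {}}" and R = "R\<inverse>"])
      (auto simp: rectangles_def twisted_le_def)
  ultimately show ?thesis by simp
qed

section \<open>The weak equivalence of filtrations\<close>

lemma filtration_realization:
  assumes "\<And>p. p \<in> P \<Longrightarrow> abstract_complex (K p)"
    and "\<And>p q. p \<in> P \<Longrightarrow> q \<in> P \<Longrightarrow> le p q \<Longrightarrow> K p \<subseteq> K q"
  shows "filtration P le (\<lambda>p. realization (K p))"
  unfolding filtration_def using assms CGWH_realization realization_subcomplex by metis

text \<open>Both comparison maps are given by formulas that mention neither the weight nor the relation, so naturality is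
immediate; the index poset can then be arbitrary, as long as \<open>m\<close> decreases and \<open>R\<close> grows along it.\<close>
lemma weakly_equivalent_dowker:
  fixes X :: "'a set" and Y :: "'b set"
  assumes pos: "\<And>i. i \<in> P \<Longrightarrow> 0 < m i"
    and mono: "\<And>i j. i \<in> P \<Longrightarrow> j \<in> P \<Longrightarrow> le i j \<Longrightarrow> m j \<le> m i \<and> R i \<subseteq> R j"
  shows "weakly_equivalent TYPE('a set \<times> 'b set \<Rightarrow> real) P le
    (\<lambda>i. realization (dowker_weight X Y (R i) (m i)))
    (\<lambda>i. realization (subdivision_filtration (dowker Y X ((R i)\<inverse>)) (m i)))"
proof -
  let ?Z = "\<lambda>i. rectangles X Y (R i) (m i)"
  let ?F = "\<lambda>i. realization (dowker_weight X Y (R i) (m i))"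
  let ?G = "\<lambda>i. realization (subdivision_filtration (dowker Y X ((R i)\<inverse>)) (m i))"
  let ?H = "\<lambda>i. realization (order_complex twisted_le (?Z i))"
  have Z_mono: "?Z i \<subseteq> ?Z j" if "i \<in> P" "j \<in> P" "le i j" for i j
    using mono[OF that] by (intro rectangles_mono) auto
  have order_mono: "order_complex le A \<subseteq> order_complex le B" if "A \<subseteq> B" for le :: "'z \<Rightarrow> 'z \<Rightarrow> bool" and A B
    using that unfolding order_complex_def by blast
  have H: "filtration P le ?H"
    by (intro filtration_realization abstract_complex_order_complex order_mono Z_mono)
  have F: "filtration P le ?F"
  proof (intro filtration_realization abstract_complex_dowker_weight)
    fix i j assume "i \<in> P" "j \<in> P" "le i j"
    then show "dowker_weight X Y (R i) (m i) \<subseteq> dowker_weight X Y (R j) (m j)"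
      using pos Z_mono by (simp add: dowker_weight_eq image_mono)
  qed
  have G: "filtration P le ?G"
    unfolding subdivision_filtration_eq Sd_eq_order_complex
    by (intro filtration_realization abstract_complex_order_complex order_mono image_mono Z_mono)
  have "homotopy_equivalence_map (?H i) (?F i) (lin bary \<circ> simplicial fst)" if "i \<in> P" for i
  proof (rule homotopy_equivalence_map_compose[OF fst_rectangles_homotopy_equivalence])
    show "homotopy_equivalence_map (realization (Sd (fst ` ?Z i))) (?F i) (lin bary)"
      unfolding dowker_weight_eq[OF pos[OF that], symmetric]
      by (intro homeomorphic_imp_homotopy_equivalence_map homeomorphic_map_lin_bary
          abstract_complex_dowker_weight)
  qed
  then have "objectwise_equivalence P le ?H ?F (\<lambda>_. lin bary \<circ> simplicial fst)"
    unfolding objectwise_equivalence_def using H F by simp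
  then have "objectwise_equivalent P le ?F ?H"
    unfolding objectwise_equivalent_def by blast
  moreover have "objectwise_equivalence P le ?H ?G (\<lambda>_. simplicial snd)"
    unfolding objectwise_equivalence_def using H G
    by (simp add: subdivision_filtration_eq snd_rectangles_homotopy_equivalence)
  then have "objectwise_equivalent P le ?H ?G"
    unfolding objectwise_equivalent_def by blast
  ultimately show ?thesis
    unfolding weakly_equivalent_def by blast
qed

theorem theorem3p3:
  fixes X :: "'a set" and Y :: "'b set"
  shows "(\<forall>R \<subseteq> X \<times> Y.
            weakly_equivalent TYPE('a set \<times> 'b set \<Rightarrow> real)
              {0<..} (\<lambda>m m'. m' \<le> m)
              (\<lambda>m. realization (dowker_weight X Y R m))
              (\<lambda>m. realization (subdivision_filtration (dowker Y X (R\<inverse>)) m)))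
       \<and> (\<forall>(T :: 't::order set) (R :: 't \<Rightarrow> ('a \<times> 'b) set).
            (\<forall>t\<in>T. R t \<subseteq> X \<times> Y) \<and> (\<forall>s\<in>T. \<forall>t\<in>T. s \<le> t \<longrightarrow> R s \<subseteq> R t) \<longrightarrow>
            weakly_equivalent TYPE('a set \<times> 'b set \<Rightarrow> real)
              ({0<..} \<times> T) (\<lambda>(m, s) (m', t). m' \<le> m \<and> s \<le> t)
              (\<lambda>(m, t). realization (dowker_weight X Y (R t) m))
              (\<lambda>(m, t). realization (subdivision_filtration (dowker Y X ((R t)\<inverse>)) m)))"
proof (intro conjI allI impI)
  fix R assume "R \<subseteq> X \<times> Y"
  show "weakly_equivalent TYPE('a set \<times> 'b set \<Rightarrow> real)
      {0<..} (\<lambda>m m'. m' \<le> m)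
      (\<lambda>m. realization (dowker_weight X Y R m))
      (\<lambda>m. realization (subdivision_filtration (dowker Y X (R\<inverse>)) m))"
    by (rule weakly_equivalent_dowker) auto
next
  fix T :: "'t set" and R :: "'t \<Rightarrow> ('a \<times> 'b) set"
  assume "(\<forall>t\<in>T. R t \<subseteq> X \<times> Y) \<and> (\<forall>s\<in>T. \<forall>t\<in>T. s \<le> t \<longrightarrow> R s \<subseteq> R t)"
  then have R: "R s \<subseteq> R t" if "s \<in> T" "t \<in> T" "s \<le> t" for s t
    using that by simp
  show "weakly_equivalent TYPE('a set \<times> 'b set \<Rightarrow> real)
      ({0<..} \<times> T) (\<lambda>(m, s) (m', t). m' \<le> m \<and> s \<le> t)
      (\<lambda>(m, t). realization (dowker_weight X Y (R t) m))
      (\<lambda>(m, t). realization (subdivision_filtration (dowker Y X ((R t)\<inverse>)) m))"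
    unfolding case_prod_beta by (rule weakly_equivalent_dowker) (simp_all add: mem_Times_iff R)
qed

end
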